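(* Let $\mu$ be a computable probability measure on the Cantor space $\Omega=\{0,1\}^{\mathbb{N}}$. Let $T:\Omega\to\Omega$ be a (partial) computable, $\mu$-almost everywhere defined, $\mu$-preserving, ergodic transformation. Let $U\subseteq\Omega$ be an effectively open set. Then for every point $\omega\in\Omega$ that is Martin-Löf random with respect to $\mu$, $$\lim_{n\to\infty}\frac1n\sum_{k=0}^{n-1}\chi_U(T^k(\omega))=\mu(U),$$ where $\chi_U$ is the indicator function of $U$.
   Context: For a finite binary string $x$, $x\Omega$ denotes the set of infinite binary sequences with prefix $x$ (an interval). A set $U\subseteq\Omega$ is effectively open if there is a computably enumerable set $S$ of finite strings such that $U=\bigcup_{x\in S}x\Omega$. A probability measure $\mu$ on $\Omega$ is computable if $\mu(x\Omega)$ is a computable real uniformly in $x$. A set $N\subseteq\Omega$ is an effectively null set (w.r.t. $\mu$) if there is an algorithm that, given a rational $\varepsilon>0$, enumerates an effectively open set of $\mu$-measure at most $\varepsilon$ containing $N$. A sequence is Martin-Löf random w.r.t. $\mu$ if it belongs to no effectively null set. Computable transformation: a Turing machine with a read-only input tape (containing an infinite binary sequence) and a write-only one-way output tape determines a map from $\Omega$ to finite and infinite binary sequences; restricting it to the inputs for which the output is infinite gives a partial computable map $T$ from $\Omega$ to $\Omega$. It is almost everywhere defined if its domain has $\mu$-measure $1$. It is $\mu$-preserving if $\mu(T^{-1}(B))=\mu(B)$ for every measurable $B$, and ergodic if every measurable $B$ that is invariant ($T^{-1}(B)=B$ up to a $\mu$-null set) has $\mu(B)\in\{0,1\}$. For $\mu$-Martin-Löf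 random $\omega$ all iterates $T^k(\omega)$ are defined. *)

theory Defs
  imports "HOL-Probability.Probability" "HOL-Library.Nat_Bijection"
begin

section \<open>Computable functions and computably enumerable sets\<close>

text \<open>
  \<open>recursive n f\<close>: on argument lists of length \<open>n\<close>, \<open>f\<close> is a total recursive function.
  Only the values on lists of length \<open>n\<close> are meaningful. Minimisation is restricted to
  functions that have a zero for all arguments, so every function in the class is total.
\<close>

inductive recursive :: "nat \<Rightarrow> (nat list \<Rightarrow> nat) \<Rightarrow> bool" where
  zero: "recursive n (\<lambda>_. 0)"
| succ: "recursive 1 (\<lambda>xs. Suc (hd xs))"
| proj: "i < n \<Longrightarrow> recursive n (\<lambda>xs. xs ! i)"
| comp: "recursive (length gs) f \<Longrightarrow> (\<forall>g\<in>set gs. recursive n g)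
    \<Longrightarrow> recursive n (\<lambda>xs. f (map (\<lambda>g. g xs) gs))"
| prim: "recursive n f \<Longrightarrow> recursive (n + 2) g
    \<Longrightarrow> recursive (n + 1)
      (\<lambda>xs. rec_nat (f (tl xs)) (\<lambda>y r. g (y # r # tl xs)) (hd xs))"
| mini: "recursive (n + 1) f \<Longrightarrow> (\<forall>xs. length xs = n \<longrightarrow> (\<exists>y. f (y # xs) = 0))
    \<Longrightarrow> recursive n (\<lambda>xs. LEAST y. f (y # xs) = 0)"

definition comp_enum :: "nat set \<Rightarrow> bool" where
  "comp_enum A \<longleftrightarrow> A = {} \<or> (\<exists>f. recursive 1 f \<and> A = range (\<lambda>n. f [n]))"

definition str_code :: "bool list \<Rightarrow> nat" where
  "str_code x = list_encode (map of_bool x)"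

text \<open>The code of a rational is that of its reduced fraction with positive denominator.\<close>

definition rat_code :: "rat \<Rightarrow> nat" where
  "rat_code q = (case quotient_of q of (a, b) \<Rightarrow> prod_encode (int_encode a, nat b))"


section \<open>Effective notions on Cantor space\<close>

text \<open>
  The \<open>\<sigma>\<close>-algebra is \<open>borel\<close> for the product topology on \<open>nat \<Rightarrow> bool\<close>.
\<close>

type_synonym cantor = "nat \<Rightarrow> bool"

definition cyl :: "bool list \<Rightarrow> cantor set" where
  "cyl x = {\<omega>. \<forall>i<length x. \<omega> i = x ! i}"

definition eff_open :: "cantor set \<Rightarrow> bool" where
  "eff_open U \<longleftrightarrow> (\<exists>S. comp_enum (str_code ` S) \<and> U = (\<Union>x\<in>S. cyl x))"

definition computable_measure :: "cantor measure \<Rightarrow> bool" where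
  "computable_measure \<mu> \<longleftrightarrow> (\<exists>f. recursive 2 f \<and>
     (\<forall>x \<epsilon>. \<epsilon> > 0 \<longrightarrow> (\<exists>q. f [str_code x, rat_code \<epsilon>] = rat_code q \<and>
        \<bar>measure \<mu> (cyl x) - real_of_rat q\<bar> \<le> real_of_rat \<epsilon>)))"

text \<open>
  An algorithm that enumerates a set of strings for each \<open>\<epsilon>\<close> is given by a single computably
  enumerable set \<open>W\<close> of coded pairs. Elements of \<open>W\<close> that do not code a pair of a rational
  and a string play no role.
\<close>

definition eff_null :: "cantor measure \<Rightarrow> cantor set \<Rightarrow> bool" where
  "eff_null \<mu> N \<longleftrightarrow> (\<exists>W. comp_enum W \<and> (\<forall>\<epsilon>>0.
     let V = (\<Union>x\<in>{x. prod_encode (rat_code \<epsilon>, str_code x) \<in> W}. cyl x)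
     in N \<subseteq> V \<and> measure \<mu> V \<le> real_of_rat \<epsilon>))"

definition mlrandom :: "cantor measure \<Rightarrow> cantor \<Rightarrow> bool" where
  "mlrandom \<mu> \<omega> \<longleftrightarrow> (\<forall>N. eff_null \<mu> N \<longrightarrow> \<omega> \<notin> N)"


section \<open>Machines with an infinite input tape\<close>

datatype move = MLeft | MStay | MRight

text \<open>
  A machine is a transition table, required to be finite wherever it is used (\<open>computes\<close>).
  It maps (state, scanned input bit, scanned work symbol) to (new state, work symbol to write,
  move of the work head, move of the input head, bit to append to the output, if any).
  The initial state and the blank work symbol are \<open>0\<close>. The machine halts when no transition
  applies.
\<close>

type_synonym machine = "nat \<times> bool \<times> nat \<Rightarrow> (nat \<times> nat \<times> move \<times> move \<times> bool option) option"

text \<open>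
  The work tape is two-way infinite: \<open>wleft\<close> lists the cells to the left of the head (nearest
  first), \<open>wright\<close> those from the head on; all further cells are blank. The input head cannot
  move left of cell \<open>0\<close>.
\<close>

record config =
  state :: nat
  inpos :: nat
  wleft :: "nat list"
  wright :: "nat list"
  out :: "bool list"

definition init :: config where
  "init = \<lparr>state = 0, inpos = 0, wleft = [], wright = [], out = []\<rparr>"

fun scan :: "nat list \<Rightarrow> nat" where
  "scan [] = 0"
| "scan (a # r) = a"

fun move_input :: "move \<Rightarrow> nat \<Rightarrow> nat" where
  "move_input MLeft p = p - 1"
| "move_input MStay p = p"
| "move_input MRight p = p + 1"

fun move_work :: "move \<Rightarrow> nat list \<times> nat list \<Rightarrow> nat list \<times> nat list" where
  "move_work MLeft (l, r) = (tl l, scan l # r)"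
| "move_work MStay (l, r) = (l, r)"
| "move_work MRight (l, r) = (scan r # l, tl r)"

definition step :: "machine \<Rightarrow> cantor \<Rightarrow> config \<Rightarrow> config" where
  "step M \<omega> c = (case M (state c, \<omega> (inpos c), scan (wright c)) of
     None \<Rightarrow> c
   | Some (s, a, wm, im, b) \<Rightarrow>
       let (l, r) = move_work wm (wleft c, a # tl (wright c))
       in \<lparr>state = s, inpos = move_input im (inpos c), wleft = l, wright = r,
           out = out c @ (case b of None \<Rightarrow> [] | Some v \<Rightarrow> [v])\<rparr>)"

definition output_after :: "machine \<Rightarrow> cantor \<Rightarrow> nat \<Rightarrow> bool list" where
  "output_after M \<omega> n = out ((step M \<omega> ^^ n) init)"

text \<open>
  As the output only grows, there is at most one \<open>\<alpha>\<close> all of whose bits are eventually written,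
  and there is one iff the output on \<open>\<omega>\<close> is infinite.
\<close>

definition computes :: "machine \<Rightarrow> (cantor \<Rightarrow> cantor option) \<Rightarrow> bool" where
  "computes M T \<longleftrightarrow> finite (dom M) \<and>
     (\<forall>\<omega> \<alpha>. T \<omega> = Some \<alpha> \<longleftrightarrow>
        (\<forall>k. \<exists>n. k < length (output_after M \<omega> n) \<and> \<alpha> k = output_after M \<omega> n ! k))"

definition computable_map :: "(cantor \<Rightarrow> cantor option) \<Rightarrow> bool" where
  "computable_map T \<longleftrightarrow> (\<exists>M. computes M T)"


section \<open>Partial transformations of a measure space\<close>

definition preimage :: "('a \<Rightarrow> 'a option) \<Rightarrow> 'a set \<Rightarrow> 'a set" where
  "preimage T B = {\<omega>. \<exists>\<alpha>\<in>B. T \<omega> = Some \<alpha>}"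

text \<open>
  Writing the measure of \<open>dom T\<close> or of a preimage presupposes that the set is measurable; this is
  made explicit because HOL measures are total.
\<close>

definition ae_defined :: "'a measure \<Rightarrow> ('a \<Rightarrow> 'a option) \<Rightarrow> bool" where
  "ae_defined \<mu> T \<longleftrightarrow> dom T \<in> sets \<mu> \<and> emeasure \<mu> (dom T) = 1"

definition preserving :: "'a measure \<Rightarrow> ('a \<Rightarrow> 'a option) \<Rightarrow> bool" where
  "preserving \<mu> T \<longleftrightarrow>
     (\<forall>B\<in>sets \<mu>. preimage T B \<in> sets \<mu> \<and> emeasure \<mu> (preimage T B) = emeasure \<mu> B)"

definition ergodic :: "'a measure \<Rightarrow> ('a \<Rightarrow> 'a option) \<Rightarrow> bool" where
  "ergodic \<mu> T \<longleftrightarrow>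
     (\<forall>B\<in>sets \<mu>. sym_diff (preimage T B) B \<in> null_sets \<mu> \<longrightarrow> emeasure \<mu> B \<in> {0, 1})"

primrec iterate :: "('a \<Rightarrow> 'a option) \<Rightarrow> nat \<Rightarrow> 'a \<Rightarrow> 'a option" where
  "iterate T 0 \<omega> = Some \<omega>"
| "iterate T (Suc k) \<omega> = Option.bind (iterate T k \<omega>) T"

end

theory Submission
  imports Defs "HOL-Library.Sublist"
begin

text \<open>
  Upper bound. For rational \<open>r > \<mu> U\<close>, the set \<open>G\<close> of points at which some average of \<open>\<chi>\<^sub>U\<close>
  exceeds \<open>r\<close> is effectively open, and it has measure less than one by the maximal ergodic
  inequality. It suffices that the orbit of a random \<open>\<omega>\<close> leaves \<open>G\<close>: from then on all averages
  are at most \<open>r\<close>. The lower bound follows from the upper bound for complements of clopen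
  subsets of \<open>U\<close>.

  To see that a random orbit leaves every effectively open \<open>V\<close> of measure less than one, fix a
  cylinder \<open>I\<close> of positive measure. By invariance,
  \<open>\<Sum>k\<le>N. \<mu> (I \<inter> T\<^sup>-\<^sup>k (- V))\<close> is the integral over \<open>T\<^sup>-\<^sup>N (- V)\<close> of the number of visits to \<open>I\<close>
  up to time \<open>N\<close>. By ergodicity this number is at least \<open>N \<mu> I / 2\<close> outside a set of small measure
  if \<open>N\<close> is large, and such an \<open>N\<close> can be found effectively because \<open>V\<close> does not occur in the
  condition. Hence a fixed proportion of \<open>I\<close> leaves \<open>V\<close> up to time \<open>N\<close>. Covering the remaining part of \<open>I\<close>
  by disjoint cylinders and iterating gives a Martin-Loef test.
\<close>

section \<open>Computable functions on coded types\<close>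

text \<open>The obstacle is that the measure of an effectively open set \<open>V\<close> can be
  approximated only from below. A test has to shrink its cover of \<omega> by a verified factor, but
  the part of a cylinder whose orbit stays in \<open>V\<close> is again open, so its smallness
  cannot be checked directly. The double counting in \<open>exit_estimate\<close> replaces it by two
  quantities that can be approximated from both sides: the measure of the cylinder and that of a
  clopen set of points seen to visit it at least \<open>p\<close> times. \<open>V\<close> enters
  only through a fixed margin: some \<open>m\<close> satisfies 4 \<le> (m + 1) (1 - \<mu> V), and a
  test may contain such a number without computing it from \<open>V\<close>. Each round then loses
  the factor 1 - 1/(m + 1). This is why measure less than one is enough for \<open>G\<close>. The
  complement of \<open>U\<close> is in general not effectively open; those of clopen subsets are,
  and their measures come arbitrarily close to 1 - \<mu> U.\<close>

text \<open>
  \<open>recursive n f\<close> also fixes the irrelevant values of \<open>f\<close> on lists of other lengths; \<open>rc\<close> ignores them.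
\<close>

definition rc :: "nat \<Rightarrow> (nat list \<Rightarrow> nat) \<Rightarrow> bool" where
  "rc n F \<longleftrightarrow> (\<exists>f. recursive n f \<and> (\<forall>xs. length xs = n \<longrightarrow> f xs = F xs))"

lemma recursive_rc: "recursive n f \<Longrightarrow> rc n f"
  unfolding rc_def by blast

lemma rc_cong: "rc n F \<Longrightarrow> (\<And>xs. length xs = n \<Longrightarrow> G xs = F xs) \<Longrightarrow> rc n G"
  unfolding rc_def by metis

lemma rc_comp:
  assumes "rc (length Gs) F" "\<forall>G\<in>set Gs. rc n G"
  shows "rc n (\<lambda>xs. F (map (\<lambda>G. G xs) Gs))"
proof -
  obtain f where f: "recursive (length Gs) f" "\<And>xs. length xs = length Gs \<Longrightarrow> f xs = F xs"
    using assms(1) unfolding rc_def by blast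
  obtain h where h: "\<And>G. G \<in> set Gs \<Longrightarrow> recursive n (h G) \<and> (\<forall>xs. length xs = n \<longrightarrow> h G xs = G xs)"
    using assms(2) unfolding rc_def by metis
  have "recursive n (\<lambda>xs. f (map (\<lambda>g. g xs) (map h Gs)))"
    by (rule recursive.comp) (use f h in auto)
  moreover have "f (map (\<lambda>g. g xs) (map h Gs)) = F (map (\<lambda>G. G xs) Gs)" if "length xs = n" for xs
  proof -
    have "map (\<lambda>g. g xs) (map h Gs) = map (\<lambda>G. G xs) Gs"
      using h that by (simp add: comp_def)
    then show ?thesis using f(2)[of "map (\<lambda>G. G xs) Gs"] by (simp del: map_map)
  qed
  ultimately show ?thesis unfolding rc_def by blast
qed

lemma rc_comp1: "rc 1 F \<Longrightarrow> rc n G \<Longrightarrow> rc n (\<lambda>xs. F [G xs])"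
  using rc_comp[of "[G]" F n] by simp

lemma rc_comp2: "rc 2 F \<Longrightarrow> rc n G \<Longrightarrow> rc n H \<Longrightarrow> rc n (\<lambda>xs. F [G xs, H xs])"
  using rc_comp[of "[G, H]" F n] by (simp add: numeral_2_eq_2)

lemma rc_proj: "i < n \<Longrightarrow> rc n (\<lambda>xs. xs ! i)"
  by (rule recursive_rc) (rule recursive.proj)

lemma rc_Suc: assumes "rc n F" shows "rc n (\<lambda>xs. Suc (F xs))"
  using rc_comp1[OF recursive_rc[OF recursive.succ] assms] by simp

lemma rc_const: "rc n (\<lambda>_. c)"
  by (induction c) (auto intro: recursive_rc recursive.zero rc_Suc)

lemma rc_drop: assumes "rc n F" shows "rc (m + n) (\<lambda>xs. F (drop m xs))"
proof -
  define Gs :: "(nat list \<Rightarrow> nat) list" where "Gs = map (\<lambda>i xs. xs ! i) [m..<m+n]"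
  have "rc (m + n) (\<lambda>xs. F (map (\<lambda>G. G xs) Gs))"
    by (rule rc_comp) (use assms in \<open>auto simp: Gs_def intro: rc_proj\<close>)
  then show ?thesis
  proof (rule rc_cong)
    fix xs :: "nat list" assume "length xs = m + n"
    then have "map (\<lambda>G. G xs) Gs = drop m xs"
      by (intro nth_equalityI) (auto simp: Gs_def)
    then show "F (drop m xs) = F (map (\<lambda>G. G xs) Gs)" by simp
  qed
qed

text \<open>The primitive recursion scheme recurses on the head of the argument list and keeps the
  tail as parameters. Composing it with \<open>K\<close> followed by all projections lets the number
  of rounds depend on the parameters, which stay available to \<open>A\<close> and
  \<open>B\<close>.\<close>

lemma rc_rec:
  assumes "rc n A" "rc (n + 2) B" "rc n K"
  shows "rc n (\<lambda>xs. rec_nat (A xs) (\<lambda>y r. B (y # r # xs)) (K xs))"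
proof -
  obtain a where a: "recursive n a" "\<And>xs. length xs = n \<Longrightarrow> a xs = A xs"
    using assms(1) unfolding rc_def by blast
  obtain b where b: "recursive (n + 2) b" "\<And>xs. length xs = n + 2 \<Longrightarrow> b xs = B xs"
    using assms(2) unfolding rc_def by blast
  define P where "P = (\<lambda>xs. rec_nat (a (tl xs)) (\<lambda>y r. b (y # r # tl xs)) (hd xs))"
  have P: "rc (n + 1) P"
    unfolding P_def by (rule recursive_rc) (rule recursive.prim[OF a(1) b(1)])
  define Gs :: "(nat list \<Rightarrow> nat) list" where "Gs = K # map (\<lambda>i xs. xs ! i) [0..<n]"
  have "rc n (\<lambda>xs. P (map (\<lambda>G. G xs) Gs))"
    by (rule rc_comp) (use assms P in \<open>auto simp: Gs_def intro: rc_proj\<close>)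
  then show ?thesis
  proof (rule rc_cong)
    fix xs :: "nat list" assume len: "length xs = n"
    then have "map (\<lambda>G. G xs) Gs = K xs # xs"
      by (auto simp: Gs_def intro!: nth_equalityI)
    moreover have "rec_nat (a xs) (\<lambda>y r. b (y # r # xs)) k = rec_nat (A xs) (\<lambda>y r. B (y # r # xs)) k" for k
      by (induction k) (use len a b in auto)
    ultimately show "rec_nat (A xs) (\<lambda>y r. B (y # r # xs)) (K xs) = P (map (\<lambda>G. G xs) Gs)"
      by (simp add: P_def)
  qed
qed

text \<open>A case distinction is a recursion whose step ignores the previous value: any positive
  number of rounds gives \<open>B xs\<close>.\<close>

lemma rc_ifz:
  assumes "rc n A" "rc n B" "rc n K"
  shows "rc n (\<lambda>xs. if K xs = 0 then A xs else B xs)"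
proof -
  have B: "rc (n + 2) (\<lambda>xs. B (drop 2 xs))"
    using rc_drop[OF assms(2), of 2] by (simp add: add.commute)
  show ?thesis
  proof (rule rc_cong[OF rc_rec[OF assms(1) B assms(3)]])
    fix xs show "(if K xs = 0 then A xs else B xs)
      = rec_nat (A xs) (\<lambda>y r. B (drop 2 (y # r # xs))) (K xs)"
      by (cases "K xs") auto
  qed
qed

lemma rc_add: assumes "rc n F" "rc n G" shows "rc n (\<lambda>xs. F xs + G xs)"
proof (rule rc_cong[OF rc_rec[OF assms(2) rc_Suc[OF rc_proj[of 1]] assms(1)]])
  fix xs
  have "f + g = rec_nat g (\<lambda>y r. Suc ((y # r # xs) ! 1)) f" for f g :: nat
    by (induction f) auto
  then show "F xs + G xs = rec_nat (G xs) (\<lambda>y r. Suc ((y # r # xs) ! 1)) (F xs)" .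
qed simp

lemma rc_pred: assumes "rc n F" shows "rc n (\<lambda>xs. F xs - 1)"
proof (rule rc_cong[OF rc_rec[OF rc_const[of _ 0] rc_proj[of 0] assms]])
  show "F xs - 1 = rec_nat 0 (\<lambda>y r. (y # r # xs) ! 0) (F xs)" for xs
    by (cases "F xs") auto
qed simp

lemma rc_diff: assumes "rc n F" "rc n G" shows "rc n (\<lambda>xs. F xs - G xs)"
proof (rule rc_cong[OF rc_rec[OF assms(1) rc_pred[OF rc_proj[of 1]] assms(2)]])
  fix xs
  have "f - g = rec_nat f (\<lambda>y r. (y # r # xs) ! 1 - 1) g" for f g :: nat
    by (induction g) auto
  then show "F xs - G xs = rec_nat (F xs) (\<lambda>y r. (y # r # xs) ! 1 - 1) (G xs)" .
qed simp

lemma rc_triangle: assumes "rc n F" shows "rc n (\<lambda>xs. triangle (F xs))"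
proof (rule rc_cong[OF rc_rec[OF rc_const[of _ 0] rc_add[OF rc_proj[of 1] rc_Suc[OF rc_proj[of 0]]] assms]])
  fix xs
  have "triangle g = rec_nat 0 (\<lambda>y r. (y # r # xs) ! 1 + Suc ((y # r # xs) ! 0)) g" for g :: nat
    by (induction g) auto
  then show "triangle (F xs) = rec_nat 0 (\<lambda>y r. (y # r # xs) ! 1 + Suc ((y # r # xs) ! 0)) (F xs)" .
qed simp_all

lemma rc_prod_encode: assumes "rc n F" "rc n G" shows "rc n (\<lambda>xs. prod_encode (F xs, G xs))"
  unfolding prod_encode_def by (simp, intro rc_add rc_triangle assms)

text \<open>The index of the diagonal that contains the pair with a given code.\<close>

definition diagonal :: "nat \<Rightarrow> nat" where
  "diagonal = rec_nat 0 (\<lambda>y r. if triangle (Suc r) - Suc y = 0 then Suc r else r)"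

lemma diagonal_bounds: "triangle (diagonal c) \<le> c \<and> c < triangle (Suc (diagonal c))"
  by (induction c) (auto simp: diagonal_def)

text \<open>The code of \<open>(a, b)\<close> is \<open>triangle (a + b) + a\<close>, so the
  diagonal index \<open>a + b\<close> determines both components. Decoding is thus expressed by
  functions already known to be recursive.\<close>

lemma prod_decode_diagonal:
  "prod_decode c = (c - triangle (diagonal c), diagonal c - (c - triangle (diagonal c)))"
proof -
  have "prod_encode (c - triangle (diagonal c), diagonal c - (c - triangle (diagonal c))) = c"
    using diagonal_bounds[of c] unfolding prod_encode_def by simp
  then show ?thesis by (metis prod_encode_inverse)
qed

lemma rc_diagonal: assumes "rc n F" shows "rc n (\<lambda>xs. diagonal (F xs))"
proof (rule rc_cong[OF rc_rec[OF rc_const[of _ 0]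
      rc_ifz[OF rc_Suc[OF rc_proj[of 1]] rc_proj[of 1]
        rc_diff[OF rc_triangle[OF rc_Suc[OF rc_proj[of 1]]] rc_Suc[OF rc_proj[of 0]]]] assms]])
qed (auto simp: diagonal_def cong: if_cong)

lemma rc_fst: "rc n F \<Longrightarrow> rc n (\<lambda>xs. fst (prod_decode (F xs)))"
  by (simp add: prod_decode_diagonal rc_diff rc_triangle rc_diagonal)

lemma rc_snd: "rc n F \<Longrightarrow> rc n (\<lambda>xs. snd (prod_decode (F xs)))"
  by (simp add: prod_decode_diagonal rc_diff rc_triangle rc_diagonal)

section \<open>Coded types and closure properties of computable functions\<close>

class enc =
  fixes enc :: "'a \<Rightarrow> nat"
  assumes enc_inj: "enc x = enc y \<Longrightarrow> x = y"

lemma enc_eq_iff [simp]: "enc x = enc y \<longleftrightarrow> x = y"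
  using enc_inj by blast

instantiation nat :: enc begin
definition enc_nat :: "nat \<Rightarrow> nat" where [simp]: "enc_nat n = n"
instance by standard simp
end

instantiation bool :: enc begin
definition enc_bool :: "bool \<Rightarrow> nat" where "enc_bool b = of_bool b"
instance by standard (simp add: enc_bool_def of_bool_def split: if_splits)
end

instantiation prod :: (enc, enc) enc begin
definition enc_prod :: "'a \<times> 'b \<Rightarrow> nat" where "enc_prod p = prod_encode (enc (fst p), enc (snd p))"
instance by standard (auto simp: enc_prod_def prod_eq_iff)
end

instantiation list :: (enc) enc begin
definition enc_list :: "'a list \<Rightarrow> nat" where "enc_list xs = list_encode (map enc xs)"
instance by standard (simp add: enc_list_def list_encode_eq inj_map_eq_map[OF injI[OF enc_inj]])
end

instantiation option :: (enc) enc begin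
definition enc_option :: "'a option \<Rightarrow> nat" where
  "enc_option z = (case z of None \<Rightarrow> 0 | Some x \<Rightarrow> Suc (enc x))"
instance by standard (auto simp: enc_option_def split: option.splits)
end

instantiation move :: enc begin
definition enc_move :: "move \<Rightarrow> nat" where
  "enc_move m = (case m of MLeft \<Rightarrow> 0 | MStay \<Rightarrow> 1 | MRight \<Rightarrow> 2)"
instance by standard (auto simp: enc_move_def split: move.splits)
end

text \<open>Only the values of \<open>g\<close> on codes matter, since \<open>enc\<close> need not
  be surjective. Functions of several arguments are treated as functions of nested pairs.\<close>

definition computable :: "('a::enc \<Rightarrow> 'b::enc) \<Rightarrow> bool" where
  "computable f \<longleftrightarrow> (\<exists>g. rc 1 (\<lambda>xs. g (xs ! 0)) \<and> (\<forall>x. g (enc x) = enc (f x)))"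

lemma computableI:
  "rc 1 (\<lambda>xs. g (xs ! 0)) \<Longrightarrow> (\<And>x. g (enc x) = enc (f x)) \<Longrightarrow> computable f"
  unfolding computable_def by blast

definition tracker :: "('a::enc \<Rightarrow> 'b::enc) \<Rightarrow> nat \<Rightarrow> nat" where
  "tracker f = (SOME g. rc 1 (\<lambda>xs. g (xs ! 0)) \<and> (\<forall>x. g (enc x) = enc (f x)))"

lemma tracker:
  assumes "computable f"
  shows "rc 1 (\<lambda>xs. tracker f (xs ! 0))" "tracker f (enc x) = enc (f x)"
  using someI_ex[OF assms[unfolded computable_def]] unfolding tracker_def by blast+

lemma rc_tracker: "computable f \<Longrightarrow> rc n F \<Longrightarrow> rc n (\<lambda>xs. tracker f (F xs))"
  using rc_comp1[OF tracker(1)] by fastforce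

named_theorems computable_intros

lemma computable_id [computable_intros]: "computable (\<lambda>x. x)"
  by (rule computableI[of "\<lambda>c. c"]) (auto intro: rc_proj)

lemma computable_const [computable_intros]: "computable (\<lambda>x. c)"
  by (rule computableI[of "\<lambda>_. enc c"]) (auto intro: rc_const)

lemma computable_compose:
  assumes "computable f" "computable g" shows "computable (\<lambda>x. f (g x))"
  by (rule computableI[of "\<lambda>c. tracker f (tracker g c)"])
    (auto intro!: rc_tracker rc_proj assms simp: tracker(2)[OF assms(1)] tracker(2)[OF assms(2)])

lemma computable_Pair [computable_intros]:
  assumes "computable f" "computable g" shows "computable (\<lambda>x. (f x, g x))"
  by (rule computableI[of "\<lambda>c. prod_encode (tracker f c, tracker g c)"])
    (auto intro!: rc_prod_encode rc_tracker rc_proj assms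
      simp: tracker(2)[OF assms(1)] tracker(2)[OF assms(2)] enc_prod_def)

lemma computable_compose2:
  assumes "computable (\<lambda>p. h (fst p) (snd p))" "computable f" "computable g"
  shows "computable (\<lambda>x. h (f x) (g x))"
  using computable_compose[OF assms(1) computable_Pair[OF assms(2,3)]] by simp

lemma computable_compose3:
  assumes "computable (\<lambda>p. h (fst p) (fst (snd p)) (snd (snd p)))"
    "computable f" "computable g" "computable k"
  shows "computable (\<lambda>x. h (f x) (g x) (k x))"
  using computable_compose[OF assms(1) computable_Pair[OF assms(2) computable_Pair[OF assms(3,4)]]] by simp

text \<open>On \<open>nat\<close> the encoding is the identity, so \<open>f\<close> and its coded
  version have the same trackers.\<close>

lemma computable_via_enc: "computable (\<lambda>x. enc (f x)) \<Longrightarrow> computable f"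
  unfolding computable_def by simp

lemma computable_enc [computable_intros]: "computable f \<Longrightarrow> computable (\<lambda>x. enc (f x))"
  unfolding computable_def by simp

lemma computable_fst [computable_intros]: "computable f \<Longrightarrow> computable (\<lambda>x. fst (f x))"
  by (rule computable_compose[of fst])
    (auto intro!: computableI[of "\<lambda>c. fst (prod_decode c)"] rc_fst rc_proj simp: enc_prod_def)

lemma computable_snd [computable_intros]: "computable f \<Longrightarrow> computable (\<lambda>x. snd (f x))"
  by (rule computable_compose[of snd])
    (auto intro!: computableI[of "\<lambda>c. snd (prod_decode c)"] rc_snd rc_proj simp: enc_prod_def)

lemma computable_case_prod [computable_intros]:
  "computable (\<lambda>x. f x (fst (g x)) (snd (g x))) \<Longrightarrow> computable (\<lambda>x. case g x of (a, b) \<Rightarrow> f x a b)"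
  by (simp add: case_prod_beta)

lemma computable_rec_nat [computable_intros]:
  assumes "computable a" "computable (\<lambda>p. b (fst p) (fst (snd p)) (snd (snd p)))" "computable k"
  shows "computable (\<lambda>x. rec_nat (a x) (\<lambda>y r. b x y r) (k x))"
proof -
  define a' where "a' = tracker a"
  define b' where "b' = tracker (\<lambda>p. b (fst p) (fst (snd p)) (snd (snd p)))"
  define k' where "k' = tracker k"
  note a' = rc_tracker[OF assms(1), folded a'_def] tracker(2)[OF assms(1), folded a'_def]
  note b' = rc_tracker[OF assms(2), folded b'_def] tracker(2)[OF assms(2), folded b'_def]
  note k' = rc_tracker[OF assms(3), folded k'_def] tracker(2)[OF assms(3), folded k'_def]
  \<comment> \<open>Indices 0, 1 and 2 hold the round counter, the previous value and the code of
    the parameter, in the order in which \<open>rc_rec\<close> supplies them.\<close>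
  define B where "B = (\<lambda>zs. b' (prod_encode (zs ! 2, prod_encode (zs ! 0, zs ! 1))))"
  have B: "rc (1 + 2) B"
    unfolding B_def by (intro b'(1) rc_prod_encode rc_proj) auto
  have "rec_nat (a' (enc x)) (\<lambda>y r. b' (prod_encode (enc x, prod_encode (y, r)))) n
    = enc (rec_nat (a x) (\<lambda>y r. b x y r) n)" for x n
  proof (induction n)
    case (Suc n)
    then show ?case using b'(2)[of "(x, n, rec_nat (a x) (b x) n)"] by (simp add: enc_prod_def)
  qed (simp add: a')
  then have eq: "rec_nat (a' (enc x)) (\<lambda>y r. b' (prod_encode (enc x, prod_encode (y, r)))) (k' (enc x))
    = enc (rec_nat (a x) (\<lambda>y r. b x y r) (k x))" for x
    by (simp add: k')
  show ?thesis
  proof (rule computableI[of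
        "\<lambda>c. rec_nat (a' c) (\<lambda>y r. b' (prod_encode (c, prod_encode (y, r)))) (k' c)", OF _ eq])
    show "rc 1 (\<lambda>xs. rec_nat (a' (xs ! 0)) (\<lambda>y r. b' (prod_encode (xs ! 0, prod_encode (y, r)))) (k' (xs ! 0)))"
      by (rule rc_cong[OF rc_rec[OF a'(1)[OF rc_proj[of 0]] B k'(1)[OF rc_proj[of 0]]]]) (auto simp: B_def)
  qed
qed

lemma computable_Suc [computable_intros]:
  "computable f \<Longrightarrow> computable (\<lambda>x. Suc (f x))"
  by (rule computable_compose[of Suc]) (auto intro!: computableI[of Suc] rc_Suc rc_proj)

lemma computable_add [computable_intros]:
  fixes f g :: "'a::enc \<Rightarrow> nat"
  assumes "computable f" "computable g" shows "computable (\<lambda>x. f x + g x)"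
proof -
  have "u + v = rec_nat v (\<lambda>_ r. Suc r) u" for u v :: nat
    by (induction u) auto
  then show ?thesis by (simp only:) (intro computable_intros assms)
qed

lemma computable_diff [computable_intros]:
  fixes f g :: "'a::enc \<Rightarrow> nat"
  assumes "computable f" "computable g" shows "computable (\<lambda>x. f x - g x)"
proof -
  have pred: "r - 1 = rec_nat 0 (\<lambda>y _. y) r" for r :: nat by (cases r) auto
  have "u - v = rec_nat u (\<lambda>_ r. rec_nat 0 (\<lambda>y _. y) r) v" for u v :: nat
    by (induction v) (auto simp flip: pred)
  then show ?thesis by (simp only:) (intro computable_intros assms)
qed

lemma computable_mult [computable_intros]:
  fixes f g :: "'a::enc \<Rightarrow> nat"
  assumes "computable f" "computable g" shows "computable (\<lambda>x. f x * g x)"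
proof -
  have "u * v = rec_nat 0 (\<lambda>_ r. v + r) u" for u v :: nat
    by (induction u) auto
  then show ?thesis by (simp only:) (intro computable_intros computable_compose[OF assms(2)] assms)
qed

lemma computable_ifz:
  assumes "computable f" "computable g" "computable k"
  shows "computable (\<lambda>x. if (k x :: nat) = 0 then f x else g x)"
proof -
  have "(if n = 0 then u else v) = rec_nat u (\<lambda>_ _. v) n" for u v :: 'b and n :: nat
    by (cases n) auto
  then show ?thesis by (simp only:) (intro computable_intros computable_compose[OF assms(2)] assms)
qed

lemma computable_if [computable_intros]:
  assumes "computable k" "computable f" "computable g"
  shows "computable (\<lambda>x. if k x then f x else g x)"
proof -
  have "(\<lambda>x. if k x then f x else g x) = (\<lambda>x. if enc (k x) = 0 then g x else f x)"
    by (auto simp: enc_bool_def)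
  then show ?thesis by (simp only:) (intro computable_ifz computable_enc assms)
qed

lemma computable_le [computable_intros]:
  fixes f g :: "'a::enc \<Rightarrow> nat"
  assumes "computable f" "computable g" shows "computable (\<lambda>x. f x \<le> g x)"
proof -
  have "(u \<le> v) = (if u - v = 0 then True else False)" for u v :: nat by auto
  then show ?thesis by (simp only:) (intro computable_ifz computable_intros assms)
qed

lemma computable_less [computable_intros]:
  fixes f g :: "'a::enc \<Rightarrow> nat"
  assumes "computable f" "computable g" shows "computable (\<lambda>x. f x < g x)"
  unfolding less_eq_Suc_le by (intro computable_intros assms)

lemma computable_conj [computable_intros]:
  assumes "computable f" "computable g" shows "computable (\<lambda>x. f x \<and> g x)"
proof -
  have "(u \<and> v) = (if u then v else False)" for u v by auto
  then show ?thesis by (simp only:) (intro computable_intros assms)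
qed

lemma computable_not [computable_intros]:
  assumes "computable f" shows "computable (\<lambda>x. \<not> f x)"
proof -
  have "(\<not> u) = (if u then False else True)" for u by auto
  then show ?thesis by (simp only:) (intro computable_intros assms)
qed

lemma computable_disj [computable_intros]:
  assumes "computable f" "computable g" shows "computable (\<lambda>x. f x \<or> g x)"
proof -
  have "(u \<or> v) = (if u then True else v)" for u v by auto
  then show ?thesis by (simp only:) (intro computable_intros assms)
qed

lemma computable_eq [computable_intros]:
  assumes "computable f" "computable g" shows "computable (\<lambda>x. f x = g x)"
proof -
  have "(f x = g x) = (enc (f x) \<le> enc (g x) \<and> enc (g x) \<le> enc (f x))" for x
    by (simp add: order_eq_iff flip: enc_eq_iff)
  then show ?thesis by (simp only:) (intro computable_intros assms)
qed

lemma computable_ex_less [computable_intros]: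
  fixes P :: "'a::enc \<Rightarrow> nat \<Rightarrow> bool"
  assumes "computable k" "computable (\<lambda>p. P (fst p) (snd p))"
  shows "computable (\<lambda>x. \<exists>i<k x. P x i)"
proof -
  have "(\<exists>i<n. P x i) = rec_nat False (\<lambda>i r. r \<or> P x i) n" for x n
    by (induction n) (auto simp: less_Suc_eq)
  then show ?thesis by (simp only:) (intro computable_intros computable_compose2[OF assms(2)] assms)
qed

lemma computable_all_less [computable_intros]:
  fixes P :: "'a::enc \<Rightarrow> nat \<Rightarrow> bool"
  assumes "computable k" "computable (\<lambda>p. P (fst p) (snd p))"
  shows "computable (\<lambda>x. \<forall>i<k x. P x i)"
proof -
  have "(\<forall>i<k x. P x i) = (\<not> (\<exists>i<k x. \<not> P x i))" for x by blast
  then show ?thesis by (simp only:) (intro computable_intros assms)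
qed

lemma computable_card_less [computable_intros]:
  fixes P :: "'a::enc \<Rightarrow> nat \<Rightarrow> bool"
  assumes "computable k" "computable (\<lambda>p. P (fst p) (snd p))"
  shows "computable (\<lambda>x. card {i. i < k x \<and> P x i})"
proof -
  have "card {i. i < n \<and> P x i} = rec_nat 0 (\<lambda>i r. if P x i then Suc r else r) n" for x n
  proof (induction n)
    case (Suc n)
    have "{i. i < Suc n \<and> P x i} = (if P x n then insert n {i. i < n \<and> P x i} else {i. i < n \<and> P x i})"
      by (auto simp: less_Suc_eq)
    then show ?case using Suc by simp
  qed simp
  then show ?thesis by (simp only:) (intro computable_intros computable_compose2[OF assms(2)] assms)
qed

lemma computable_div [computable_intros]:
  fixes f g :: "'a::enc \<Rightarrow> nat"
  assumes "computable f" "computable g" shows "computable (\<lambda>x. f x div g x)"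
proof -
  \<comment> \<open>The quotient counts the positive multiples of \<open>v\<close> that are at most
    \<open>u\<close>. Division by zero has the value 0 and is split off.\<close>
  have "u div v = (if v = 0 then 0 else card {i. i < u \<and> Suc i * v \<le> u})" for u v :: nat
  proof (cases "v = 0")
    case False
    have "{i. i < u \<and> Suc i * v \<le> u} = {..<u div v}"
    proof -
      have "i < u \<and> Suc i * v \<le> u \<longleftrightarrow> i < u div v" for i
      proof -
        have "Suc i * v \<le> u \<longleftrightarrow> Suc i \<le> u div v"
          using False by (simp add: less_eq_div_iff_mult_less_eq)
        moreover have "u div v \<le> u" by simp
        ultimately show ?thesis by linarith
      qed
      then show ?thesis by blast
    qed
    then show ?thesis using False by simp
  qed simp
  then show ?thesis
    by (simp only:) (intro computable_intros computable_compose[OF assms(1)] computable_compose[OF assms(2)] assms)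
qed

lemma computable_funpow [computable_intros]:
  fixes h :: "'a::enc \<Rightarrow> 'b::enc \<Rightarrow> 'b"
  assumes "computable k" "computable (\<lambda>p. h (fst p) (snd p))" "computable f"
  shows "computable (\<lambda>x. (h x ^^ k x) (f x))"
proof -
  have "(h x ^^ n) y = rec_nat y (\<lambda>_ r. h x r) n" for x y n
    by (induction n) auto
  then show ?thesis by (simp only:) (intro computable_intros computable_compose2[OF assms(2)] assms)
qed

lemma enc_Nil [simp]: "enc [] = 0"
  by (simp add: enc_list_def)

lemma enc_Cons [simp]: "enc (x # xs) = Suc (enc (x, xs))"
  by (simp add: enc_list_def enc_prod_def)

lemma computable_Cons [computable_intros]:
  assumes "computable f" "computable g" shows "computable (\<lambda>x. f x # g x)"
  by (rule computable_via_enc) (simp, intro computable_intros assms)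

text \<open>Common core of the case distinctions on lists and options: code 0 is the empty case, any
  other code is the successor of the code of the contents \<open>d x\<close>. The contents are
  obtained by taking the predecessor of the code, so \<open>hd\<close>, \<open>tl\<close> and
  \<open>the\<close> are never tracked separately.\<close>

lemma computable_code_pred:
  assumes k: "computable k" "\<And>x. k x \<noteq> 0 \<Longrightarrow> k x = Suc (enc (d x))"
    and f: "computable f" and g: "computable (\<lambda>p. g (fst p) (snd p))"
  shows "computable (\<lambda>x. if (k x :: nat) = 0 then f x else g x (d x))"
proof -
  define f' where "f' = tracker f"
  define g' where "g' = tracker (\<lambda>p. g (fst p) (snd p))"
  define k' where "k' = tracker k"
  note f' = rc_tracker[OF f, folded f'_def] tracker(2)[OF f, folded f'_def]
  note g' = rc_tracker[OF g, folded g'_def] tracker(2)[OF g, folded g'_def]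
  note k' = rc_tracker[OF k(1), folded k'_def] tracker(2)[OF k(1), folded k'_def]
  show ?thesis
  proof (rule computableI[of "\<lambda>c. if k' c = 0 then f' c else g' (prod_encode (c, k' c - 1))"])
    show "rc 1 (\<lambda>xs. if k' (xs ! 0) = 0 then f' (xs ! 0) else g' (prod_encode (xs ! 0, k' (xs ! 0) - 1)))"
      by (intro rc_ifz f'(1) g'(1) k'(1) rc_prod_encode rc_pred rc_proj) auto
    show "(if k' (enc x) = 0 then f' (enc x) else g' (prod_encode (enc x, k' (enc x) - 1)))
      = enc (if k x = 0 then f x else g x (d x))" for x
      using k(2)[of x] g'(2)[of "(x, d x)"] by (cases "k x = 0") (simp_all add: k' f' enc_prod_def)
  qed
qed

lemma computable_case_list [computable_intros]:
  assumes "computable l" "computable f"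
    and "computable (\<lambda>p. g (fst p) (fst (snd p)) (snd (snd p)))"
  shows "computable (\<lambda>x. case l x of [] \<Rightarrow> f x | a # r \<Rightarrow> g x a r)"
proof -
  have eq: "(\<lambda>x. case l x of [] \<Rightarrow> f x | a # r \<Rightarrow> g x a r)
    = (\<lambda>x. if enc (l x) = 0 then f x else (\<lambda>x q. g x (fst q) (snd q)) x (hd (l x), tl (l x)))"
    by (auto split: list.splits)
  show ?thesis unfolding eq
  proof (rule computable_code_pred[where d = "\<lambda>x. (hd (l x), tl (l x))"])
    show "computable (\<lambda>x. enc (l x))" by (intro computable_intros assms)
    show "enc (l x) = Suc (enc (hd (l x), tl (l x)))" if "enc (l x) \<noteq> 0" for x
      using that by (cases "l x") auto
  qed (use assms in auto)
qed

lemma computable_case_option [computable_intros]: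
  assumes "computable l" "computable f" "computable (\<lambda>p. g (fst p) (snd p))"
  shows "computable (\<lambda>x. case l x of None \<Rightarrow> f x | Some a \<Rightarrow> g x a)"
proof -
  have eq: "(\<lambda>x. case l x of None \<Rightarrow> f x | Some a \<Rightarrow> g x a)
    = (\<lambda>x. if enc (l x) = 0 then f x else g x (the (l x)))"
    by (auto simp: enc_option_def split: option.splits)
  show ?thesis unfolding eq
  proof (rule computable_code_pred[where d = "\<lambda>x. the (l x)"])
    show "computable (\<lambda>x. enc (l x))" by (intro computable_intros assms)
    show "enc (l x) = Suc (enc (the (l x)))" if "enc (l x) \<noteq> 0" for x
      using that by (cases "l x") (auto simp: enc_option_def)
  qed (use assms in auto)
qed

lemma length_le_enc: "length xs \<le> enc xs"
proof (induction xs)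
  case (Cons a xs)
  have "enc xs \<le> enc (a, xs)" by (simp add: enc_prod_def le_prod_encode_2)
  then show ?case using Cons by simp
qed simp

text \<open>The fold is iterated as a map on pairs of remaining list and accumulator. An exhausted
  list leaves the pair fixed, so any number of rounds not below the length will do; by
  \<open>length_le_enc\<close> the code of the list is such a number.\<close>

lemma computable_foldl [computable_intros]:
  assumes h: "computable (\<lambda>p. h (fst p) (fst (snd p)) (snd (snd p)))"
    and "computable a" "computable l"
  shows "computable (\<lambda>x. foldl (h x) (a x) (l x))"
proof -
  define st where "st x s = (case fst s of [] \<Rightarrow> s | y # ys \<Rightarrow> (ys, h x (snd s) y))" for x s
  have eq: "snd ((st x ^^ n) (l, a)) = foldl (h x) a l" if "length l \<le> n" for x l a n
    using that
  proof (induction n arbitrary: l a)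
    case (Suc n)
    show ?case
      by (cases l) (use Suc in \<open>auto simp: st_def funpow_Suc_right simp del: funpow.simps\<close>)
  qed simp
  have st: "computable (\<lambda>p. st (fst p) (snd p))"
    unfolding st_def by (intro computable_intros computable_compose3[OF h])
  have "foldl (h x) (a x) (l x) = snd ((st x ^^ enc (l x)) (l x, a x))" for x
    using eq[OF length_le_enc] by simp
  then show ?thesis by (simp only:) (intro computable_intros computable_compose2[OF st] assms)
qed

lemma computable_length [computable_intros]:
  assumes "computable l" shows "computable (\<lambda>x. length (l x))"
proof -
  have "length xs = foldl (\<lambda>n _. Suc n) 0 xs" for xs :: "'b list"
    by (induction xs rule: rev_induct) auto
  then show ?thesis by (simp only:) (intro computable_intros assms)
qed

lemma computable_rev [computable_intros]:
  assumes "computable l" shows "computable (\<lambda>x. rev (l x))"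
proof -
  have "rev xs = foldl (\<lambda>acc a. a # acc) [] xs" for xs :: "'b list"
    by (induction xs rule: rev_induct) auto
  then show ?thesis by (simp only:) (intro computable_intros assms)
qed

lemma computable_append [computable_intros]:
  assumes "computable l" "computable r" shows "computable (\<lambda>x. l x @ r x)"
proof -
  have "xs @ ys = foldl (\<lambda>acc a. a # acc) ys (rev xs)" for xs ys :: "'b list"
    by (induction xs arbitrary: ys) auto
  then show ?thesis by (simp only:) (intro computable_intros assms)
qed

lemma computable_map [computable_intros]:
  fixes h :: "'a::enc \<Rightarrow> 'b::enc \<Rightarrow> 'c::enc"
  assumes "computable (\<lambda>p. h (fst p) (snd p))" "computable l"
  shows "computable (\<lambda>x. map (h x) (l x))"
proof -
  have "map f xs = foldl (\<lambda>acc a. acc @ [f a]) [] xs" for f :: "'b \<Rightarrow> 'c" and xs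
    by (induction xs rule: rev_induct) auto
  then show ?thesis by (simp only:) (intro computable_intros computable_compose2[OF assms(1)] assms)
qed

lemma computable_sum_list [computable_intros]:
  fixes l :: "'a::enc \<Rightarrow> nat list"
  assumes "computable l" shows "computable (\<lambda>x. sum_list (l x))"
proof -
  have "sum_list xs = foldl (\<lambda>acc a. acc + a) 0 xs" for xs :: "nat list"
    by (induction xs rule: rev_induct) auto
  then show ?thesis by (simp only:) (intro computable_intros assms)
qed

lemma computable_tl [computable_intros]:
  assumes "computable l" shows "computable (\<lambda>x. tl (l x))"
  unfolding tl_def by (intro computable_intros assms)

lemma computable_drop [computable_intros]:
  assumes "computable k" "computable l" shows "computable (\<lambda>x. drop (k x) (l x))"
proof -
  have "drop n xs = (tl ^^ n) xs" for n and xs :: "'b list"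
    by (induction n arbitrary: xs) (auto simp: drop_Suc funpow_swap1)
  then show ?thesis by (simp only:) (intro computable_intros assms)
qed

lemma computable_take [computable_intros]:
  assumes "computable k" "computable l" shows "computable (\<lambda>x. take (k x) (l x))"
proof -
  have "take n xs = rev (drop (length xs - n) (rev xs))" for n and xs :: "'b list"
    by (cases "n \<le> length xs") (auto simp: rev_drop)
  then show ?thesis by (simp only:) (intro computable_intros assms)
qed

lemma prefix_iff_take: "prefix x y \<longleftrightarrow> take (length x) y = x"
  by (metis append_eq_conv_conj append_take_drop_id prefix_def)

lemma prefix_nth: "prefix x y \<Longrightarrow> i < length x \<Longrightarrow> y ! i = x ! i"
  by (auto simp: prefix_def nth_append)

lemma computable_prefix [computable_intros]:
  assumes "computable f" "computable g" shows "computable (\<lambda>x. prefix (f x) (g x))"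
  unfolding prefix_iff_take by (intro computable_intros assms)

lemma computable_list_decode [computable_intros]:
  assumes "computable f" shows "computable (\<lambda>x. list_decode (f x))"
proof -
  have eq: "enc (list_decode n) = n" for n
    by (simp add: enc_list_def map_idI)
  show ?thesis by (rule computable_via_enc) (simp add: assms eq)
qed

lemma computable_prod_decode [computable_intros]:
  assumes "computable f" shows "computable (\<lambda>x. prod_decode (f x))"
proof -
  have eq: "enc (prod_decode n) = n" for n
    by (simp add: enc_prod_def)
  show ?thesis by (rule computable_via_enc) (simp add: assms eq)
qed

lemma computable_odd [computable_intros]:
  assumes "computable f" shows "computable (\<lambda>x. odd (f x :: nat))"
proof -
  have "odd n \<longleftrightarrow> n - 2 * (n div 2) = 1" for n :: nat by presburger
  then show ?thesis by (simp only:) (intro computable_intros assms)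
qed

lemma str_code_enc: "str_code x = enc x"
  by (simp add: str_code_def enc_list_def enc_bool_def[abs_def])

lemma computable_recursive1:
  assumes "recursive 1 f" "computable a" shows "computable (\<lambda>x. f [a x])"
proof (rule computable_compose[OF _ assms(2)])
  show "computable (\<lambda>n. f [n])"
    by (rule computableI[OF rc_comp1[OF recursive_rc[OF assms(1)] rc_proj]]) simp_all
qed

lemma computable_recursive2:
  assumes "recursive 2 f" "computable a" "computable b" shows "computable (\<lambda>x. f [a x, b x])"
proof (rule computable_compose2[OF _ assms(2,3)])
  show "computable (\<lambda>p. f [fst p, snd p])"
    by (rule computableI[of "\<lambda>c. f [fst (prod_decode c), snd (prod_decode c)]",
          OF rc_comp2[OF recursive_rc[OF assms(1)] rc_fst[OF rc_proj] rc_snd[OF rc_proj]]])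
      (simp_all add: enc_prod_def)
qed

text \<open>A nonempty enumerable set needs a total enumerating function, so inputs that fail
  \<open>P\<close> are sent to the value at one fixed input satisfying it.\<close>

lemma comp_enum_image:
  fixes P :: "nat \<Rightarrow> bool" and g :: "nat \<Rightarrow> nat"
  assumes "computable P" "computable g"
  shows "comp_enum (g ` {z. P z})"
proof (cases "\<exists>z. P z")
  case True
  then obtain z0 where z0: "P z0" by blast
  have "computable (\<lambda>z. if P z then g z else g z0)"
    by (intro computable_intros assms)
  from tracker[OF this] obtain h where h: "rc 1 (\<lambda>xs. h (xs ! 0))"
    "\<And>z. h z = (if P z then g z else g z0)" by (simp del: One_nat_def)
  then obtain f where f: "recursive 1 f" "\<And>xs. length xs = 1 \<Longrightarrow> f xs = h (xs ! 0)"
    unfolding rc_def by blast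
  have "g ` {z. P z} = range (\<lambda>n. f [n])"
    using z0 by (auto simp: f(2) h(2) image_iff)
  then show ?thesis unfolding comp_enum_def using f(1) by blast
qed (simp add: comp_enum_def)

primrec strings :: "nat \<Rightarrow> bool list list" where
  "strings 0 = [[]]"
| "strings (Suc n) = map ((#) True) (strings n) @ map ((#) False) (strings n)"

lemma set_strings: "set (strings n) = {y. length y = n}"
proof (induction n)
  case (Suc n)
  have "{y. length y = Suc n} = (#) True ` {y. length y = n} \<union> (#) False ` {y. length y = n}"
    by (auto simp: length_Suc_conv image_iff)
  then show ?case using Suc by simp
qed simp

lemma distinct_strings: "distinct (strings n)"
  by (induction n) (auto simp: distinct_map)

lemma computable_strings [computable_intros]:
  assumes "computable f" shows "computable (\<lambda>x. strings (f x))"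
proof -
  have "strings n = rec_nat [[]] (\<lambda>_ l. map (\<lambda>y. True # y) l @ map (\<lambda>y. False # y) l) n" for n
    by (induction n) auto
  then show ?thesis by (simp only:) (intro computable_intros assms)
qed

text \<open>The certificates of the tests below compare sums of approximate measures over strings of
  one length. The index set is traversed through the duplicate-free list
  \<open>strings\<close>.\<close>

lemma computable_sum_strings [computable_intros]:
  fixes g :: "'a::enc \<Rightarrow> bool list \<Rightarrow> nat"
  assumes "computable k" "computable (\<lambda>p. P (fst p) (snd p))" "computable (\<lambda>p. g (fst p) (snd p))"
  shows "computable (\<lambda>x. \<Sum>y\<in>{y. length y = k x \<and> P x y}. g x y)"
proof -
  have "(\<Sum>y\<in>{y. length y = n \<and> P x y}. g x y)
    = sum_list (map (\<lambda>y. if P x y then g x y else 0) (strings n))" for x n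
  proof -
    have "{y. length y = n \<and> P x y} = {y \<in> set (strings n). P x y}" by (simp add: set_strings)
    then show ?thesis
      by (simp add: sum_list_distinct_conv_sum_set distinct_strings sum.inter_filter)
  qed
  then show ?thesis
    by (simp only:) (intro computable_intros computable_compose2[OF assms(2)] computable_compose2[OF assms(3)] assms)
qed

section \<open>Machines acting on finite strings\<close>

definition initial :: "cantor \<Rightarrow> nat \<Rightarrow> bool list" where
  "initial \<omega> n = map \<omega> [0..<n]"

lemma length_initial [simp]: "length (initial \<omega> n) = n"
  by (simp add: initial_def)

lemma nth_initial [simp]: "i < n \<Longrightarrow> initial \<omega> n ! i = \<omega> i"
  by (simp add: initial_def)

lemma take_initial [simp]: "take m (initial \<omega> n) = initial \<omega> (min m n)"
  by (rule nth_equalityI) auto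

lemma prefix_initial: "m \<le> n \<Longrightarrow> prefix (initial \<omega> m) (initial \<omega> n)"
  by (simp add: prefix_iff_take min_absorb1)

lemma cyl_iff_initial: "\<omega> \<in> cyl x \<longleftrightarrow> initial \<omega> (length x) = x"
  by (auto simp: cyl_def list_eq_iff_nth_eq)

lemma prefix_initial_iff: "prefix x (initial \<omega> n) \<longleftrightarrow> length x \<le> n \<and> \<omega> \<in> cyl x"
  by (auto simp: prefix_iff_take cyl_iff_initial min_def)

lemma exists_extension: "\<exists>\<omega>. initial \<omega> (length y) = y"
  by (rule exI[of _ "\<lambda>i. y ! i"]) (auto intro: nth_equalityI)

lemma computable_finite_map:
  fixes M :: "'a::enc \<Rightarrow> 'b::enc option"
  assumes "finite (dom M)" shows "computable M"
proof -
  have "computable (\<lambda>x. if x \<in> D then M x else None)" if "finite D" for D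
    using that
  proof (induction D)
    case empty
    then show ?case by (simp add: computable_const)
  next
    case (insert a D)
    have "(\<lambda>x. if x \<in> insert a D then M x else None)
      = (\<lambda>x. if x = a then M a else if x \<in> D then M x else None)" by auto
    then show ?case by (simp only:) (intro computable_intros insert)
  qed
  from this[OF assms] show ?thesis
    by (rule back_subst[of computable]) (auto simp: domIff)
qed

lemma computable_scan [computable_intros]:
  assumes "computable f" shows "computable (\<lambda>x. scan (f x))"
proof -
  have "scan l = (case l of [] \<Rightarrow> 0 | a # r \<Rightarrow> a)" for l by (cases l) auto
  then show ?thesis by (simp only:) (intro computable_intros assms)
qed

lemma computable_move_input [computable_intros]:
  assumes "computable m" "computable f" shows "computable (\<lambda>x. move_input (m x) (f x))"
proof -
  have "move_input m p = (if m = MLeft then p - 1 else if m = MStay then p else p + 1)" for m p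
    by (cases m) auto
  then show ?thesis by (simp only:) (intro computable_intros assms)
qed

lemma computable_move_work [computable_intros]:
  assumes "computable m" "computable f" "computable g"
  shows "computable (\<lambda>x. move_work (m x) (f x, g x))"
proof -
  have "move_work m (l, r)
    = (if m = MLeft then (tl l, scan l # r) else if m = MStay then (l, r) else (scan r # l, tl r))" for m l r
    by (cases m) auto
  then show ?thesis by (simp only:) (intro computable_intros assms)
qed

text \<open>
  A run on a finite string: the machine is frozen as soon as its head leaves the string.
  Configurations are tuples here, so that they can be coded.
\<close>

type_synonym tuple_config = "nat \<times> nat \<times> nat list \<times> nat list \<times> bool list"

definition config_tuple :: "config \<Rightarrow> tuple_config" where
  "config_tuple c = (state c, inpos c, wleft c, wright c, out c)"

definition string_step :: "machine \<Rightarrow> bool list \<Rightarrow> tuple_config \<Rightarrow> tuple_config" where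
  "string_step M y t = (case t of (s, p, l, r, z) \<Rightarrow>
     (case drop p y of [] \<Rightarrow> t | b # _ \<Rightarrow>
       (case M (s, b, scan r) of None \<Rightarrow> t | Some v \<Rightarrow>
         (case v of (s', a, wm, im, u) \<Rightarrow>
           (s', move_input im p, fst (move_work wm (l, a # tl r)), snd (move_work wm (l, a # tl r)),
            z @ (case u of None \<Rightarrow> [] | Some v \<Rightarrow> [v]))))))"

text \<open>The number of steps is the length of the string. This makes the map total, while the
  prefixes of an infinite input still allow arbitrarily many steps.\<close>

definition string_map :: "machine \<Rightarrow> bool list \<Rightarrow> bool list" where
  "string_map M y = snd (snd (snd (snd ((string_step M y ^^ length y) (config_tuple init)))))"

lemma computable_string_map:
  assumes "finite (dom M)" shows "computable (string_map M)"
proof -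
  have "computable (\<lambda>p. string_step M (fst p) (snd p))"
    unfolding string_step_def
    by (intro computable_intros computable_compose[OF computable_finite_map[OF assms]])
  note step = computable_compose2[OF this]
  show ?thesis
    unfolding string_map_def[abs_def] by (intro computable_intros step)
qed

lemma string_step_blocked:
  "length y \<le> inpos c \<Longrightarrow> string_step M y (config_tuple c) = config_tuple c"
  by (simp add: string_step_def config_tuple_def)

lemma string_step_initial:
  assumes "inpos c < n"
  shows "string_step M (initial \<omega> n) (config_tuple c) = config_tuple (step M \<omega> c)"
proof -
  have "drop (inpos c) (initial \<omega> n) = \<omega> (inpos c) # drop (Suc (inpos c)) (initial \<omega> n)"
    using assms by (simp add: Cons_nth_drop_Suc[symmetric])
  then show ?thesis
    by (auto simp: string_step_def config_tuple_def step_def Let_def split: option.splits prod.splits)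
qed

section \<open>Comparison of runs on a string and on an infinite input\<close>

context
  fixes M :: machine and \<omega> :: cantor
begin

abbreviation run :: "nat \<Rightarrow> config" where
  "run n \<equiv> (step M \<omega> ^^ n) init"

lemma inpos_run: "inpos (run n) \<le> n"
proof (induction n)
  case (Suc n)
  have "move_input m p \<le> Suc p" for m p by (cases m) auto
  then have "inpos (step M \<omega> c) \<le> Suc (inpos c)" for c
    by (auto simp: step_def Let_def split: option.splits prod.splits)
  from this[of "run n"] show ?case using Suc by simp
qed (simp add: init_def)

lemma output_after_mono: "m \<le> n \<Longrightarrow> prefix (output_after M \<omega> m) (output_after M \<omega> n)"
proof (induction rule: dec_induct)
  case (step n)
  have "prefix (out c) (out (Defs.step M \<omega> c))" for c
    by (auto simp: step_def Let_def split: option.splits prod.splits)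
  from this[of "run n"] show ?case using step unfolding output_after_def
    by (auto intro: prefix_order.trans)
qed simp

text \<open>The two runs agree until the steps are used up or the head leaves the string;
  \<open>m\<close> is the length of the common part. The clause on \<open>j < m\<close> makes the
  values of \<open>m\<close> for different strings comparable.\<close>

lemma string_run:
  "\<exists>m\<le>n. (string_step M (initial \<omega> l) ^^ n) (config_tuple init) = config_tuple (run m)
     \<and> (\<forall>j<m. inpos (run j) < l) \<and> (m = n \<or> l \<le> inpos (run m))"
proof (induction n)
  case (Suc n)
  then obtain m where m: "m \<le> n"
    "(string_step M (initial \<omega> l) ^^ n) (config_tuple init) = config_tuple (run m)"
    "\<forall>j<m. inpos (run j) < l" "m = n \<or> l \<le> inpos (run m)" by blast
  show ?case
  proof (cases "l \<le> inpos (run m)")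
    case True
    then show ?thesis using m by (intro exI[of _ m]) (auto simp: string_step_blocked)
  next
    case False
    then have "m = n" using m by blast
    then show ?thesis using m False
      by (intro exI[of _ "Suc n"]) (auto simp: string_step_initial less_Suc_eq)
  qed
qed simp

lemma string_map_run:
  "\<exists>m\<le>l. string_map M (initial \<omega> l) = output_after M \<omega> m
    \<and> (\<forall>j<m. inpos (run j) < l) \<and> (m = l \<or> l \<le> inpos (run m))"
proof -
  obtain m where "m \<le> l" "(string_step M (initial \<omega> l) ^^ l) (config_tuple init) = config_tuple (run m)"
    "\<forall>j<m. inpos (run j) < l" "m = l \<or> l \<le> inpos (run m)"
    using string_run by blast
  then show ?thesis
    by (intro exI[of _ m]) (simp add: string_map_def output_after_def config_tuple_def)
qed

end

text \<open>Both strings are prefixes of one infinite input, so the results are outputs of the same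
  run at times \<open>m\<close> and \<open>m'\<close>. If \<open>m' < m\<close>, the run on
  \<open>y\<close> would have been cut short because the head had left \<open>y\<close>; but before
  time \<open>m\<close> the head has not even left \<open>x\<close>.\<close>

lemma string_map_mono:
  assumes "prefix x y" shows "prefix (string_map M x) (string_map M y)"
proof -
  obtain \<omega> where \<omega>: "initial \<omega> (length y) = y" using exists_extension by blast
  have le: "length x \<le> length y" using assms by (rule prefix_length_le)
  then have "initial \<omega> (length x) = x"
    using assms \<omega> by (metis min_absorb1 prefix_iff_take take_initial)
  then obtain m where m: "m \<le> length x" "string_map M x = output_after M \<omega> m"
    "\<forall>j<m. inpos ((step M \<omega> ^^ j) init) < length x"
    using string_map_run[where M = M and \<omega> = \<omega> and l = "length x"] by metis
  obtain m' where m': "string_map M y = output_after M \<omega> m'"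
    "m' = length y \<or> length y \<le> inpos ((step M \<omega> ^^ m') init)"
    using string_map_run[where M = M and \<omega> = \<omega> and l = "length y"] \<omega> by metis
  have "m \<le> m'"
  proof (rule ccontr)
    assume "\<not> m \<le> m'"
    then have "m' < m" by simp
    then show False using m m' le by fastforce
  qed
  then show ?thesis using m m' output_after_mono by metis
qed

text \<open>From here on a computable map is represented by a monotone computable function on
  strings, whose values along the prefixes of \<omega> converge to the image of \<omega>.\<close>

theorem computable_map_string_map:
  assumes "computable_map T"
  obtains H where "computable H" "\<And>x y. prefix x y \<Longrightarrow> prefix (H x) (H y)"
    "\<And>\<omega> \<alpha>. T \<omega> = Some \<alpha> \<longleftrightarrow>
       (\<forall>k. \<exists>l. k < length (H (initial \<omega> l)) \<and> H (initial \<omega> l) ! k = \<alpha> k)"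
proof -
  obtain M where M: "finite (dom M)" "\<And>\<omega> \<alpha>. T \<omega> = Some \<alpha> \<longleftrightarrow>
        (\<forall>k. \<exists>n. k < length (output_after M \<omega> n) \<and> \<alpha> k = output_after M \<omega> n ! k)"
    using assms unfolding computable_map_def computes_def by blast
  have "(\<exists>n. k < length (output_after M \<omega> n) \<and> \<alpha> k = output_after M \<omega> n ! k) \<longleftrightarrow>
    (\<exists>l. k < length (string_map M (initial \<omega> l)) \<and> string_map M (initial \<omega> l) ! k = \<alpha> k)" for \<omega> \<alpha> k
  proof (intro iffI; elim exE conjE)
    fix n assume n: "k < length (output_after M \<omega> n)" "\<alpha> k = output_after M \<omega> n ! k"
    obtain m where m: "string_map M (initial \<omega> n) = output_after M \<omega> m"
      "m = n \<or> n \<le> inpos ((step M \<omega> ^^ m) init)"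
      using string_map_run by blast
    \<comment> \<open>The head moves right by at most one cell per step, so it cannot leave a prefix
      of length \<open>n\<close> before time \<open>n\<close>.\<close>
    then have "n \<le> m" using inpos_run order_trans by blast
    then obtain zs where "output_after M \<omega> m = output_after M \<omega> n @ zs"
      using output_after_mono prefixE by blast
    then show "\<exists>l. k < length (string_map M (initial \<omega> l)) \<and> string_map M (initial \<omega> l) ! k = \<alpha> k"
      using n m by (intro exI[of _ n]) (simp add: nth_append)
  next
    fix l assume "k < length (string_map M (initial \<omega> l))" "string_map M (initial \<omega> l) ! k = \<alpha> k"
    then show "\<exists>n. k < length (output_after M \<omega> n) \<and> \<alpha> k = output_after M \<omega> n ! k"
      using string_map_run[where M = M and \<omega> = \<omega> and l = l] by metis
  qed
  then show ?thesis
    using that[of "string_map M"] M computable_string_map string_map_mono by simp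
qed

section \<open>Maximal ergodic inequality\<close>

locale measure_preserving = prob_space M for M :: "'a measure" +
  fixes \<tau> :: "'a \<Rightarrow> 'a"
  assumes measurable_map [measurable]: "\<tau> \<in> measurable M M"
    and distr_map: "distr M M \<tau> = M"
begin

definition birkhoff_sum :: "('a \<Rightarrow> real) \<Rightarrow> nat \<Rightarrow> 'a \<Rightarrow> real" where
  "birkhoff_sum f n \<omega> = (\<Sum>k<n. f ((\<tau> ^^ k) \<omega>))"

lemma birkhoff_sum_0 [simp]: "birkhoff_sum f 0 \<omega> = 0"
  by (simp add: birkhoff_sum_def)

lemma birkhoff_sum_Suc: "birkhoff_sum f (Suc n) \<omega> = f \<omega> + birkhoff_sum f n (\<tau> \<omega>)"
  unfolding birkhoff_sum_def sum.lessThan_Suc_shift by (simp add: funpow_swap1)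

lemma measurable_funpow_map [measurable]: "\<tau> ^^ k \<in> measurable M M"
  by (induction k) (auto simp: id_def intro: measurable_comp[OF _ measurable_map])

lemma distr_funpow: "distr M M (\<tau> ^^ k) = M"
proof (induction k)
  case 0
  then show ?case by (simp add: id_def distr_id)
next
  case (Suc k)
  have "distr M M (\<tau> \<circ> \<tau> ^^ k) = distr (distr M M (\<tau> ^^ k)) M \<tau>"
    by (simp add: distr_distr)
  then show ?case by (simp only: funpow.simps Suc distr_map)
qed

lemma birkhoff_sum_measurable [measurable]:
  assumes [measurable]: "f \<in> borel_measurable M"
  shows "birkhoff_sum f n \<in> borel_measurable M"
  unfolding birkhoff_sum_def by measurable

lemma measure_funpow_vimage:
  assumes [measurable]: "A \<in> sets M"
  shows "prob ((\<tau> ^^ k) -` A \<inter> space M) = prob A"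
  using measure_distr[of "\<tau> ^^ k" M M A] by (simp add: distr_funpow)

lemma AE_funpow:
  assumes "AE \<omega> in M. P \<omega>" shows "AE \<omega> in M. P ((\<tau> ^^ k) \<omega>)"
proof -
  obtain N where N: "{\<omega> \<in> space M. \<not> P \<omega>} \<subseteq> N" "N \<in> sets M" "emeasure M N = 0"
    using assms by (rule AE_E)
  have "(\<tau> ^^ k) -` N \<inter> space M \<in> null_sets M"
  proof (rule null_setsI)
    show "(\<tau> ^^ k) -` N \<inter> space M \<in> sets M" using N(2) by measurable
    show "emeasure M ((\<tau> ^^ k) -` N \<inter> space M) = 0"
      using emeasure_distr[of "\<tau> ^^ k" M M N] N by (simp add: distr_funpow)
  qed
  then show ?thesis
  proof (rule AE_I')
    show "{\<omega> \<in> space M. \<not> P ((\<tau> ^^ k) \<omega>)} \<subseteq> (\<tau> ^^ k) -` N \<inter> space M"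
      using N(1) measurable_space[OF measurable_funpow_map[of k]] by blast
  qed
qed

text \<open>\<open>birkhoff_max f n \<omega>\<close> is the maximum of the Birkhoff sums of lengths \<open>0, \<dots>, n\<close>.\<close>

primrec birkhoff_max :: "('a \<Rightarrow> real) \<Rightarrow> nat \<Rightarrow> 'a \<Rightarrow> real" where
  "birkhoff_max f 0 \<omega> = 0"
| "birkhoff_max f (Suc n) \<omega> = max 0 (f \<omega> + birkhoff_max f n (\<tau> \<omega>))"

lemma birkhoff_max_nonneg: "0 \<le> birkhoff_max f n \<omega>"
  by (cases n) auto

lemma birkhoff_max_mono: "birkhoff_max f n \<omega> \<le> birkhoff_max f (Suc n) \<omega>"
proof (induction n arbitrary: \<omega>)
  case (Suc n)
  show ?case using Suc[of "\<tau> \<omega>"] unfolding birkhoff_max.simps(2) by linarith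
qed simp

lemma birkhoff_sum_le_max: "birkhoff_sum f n \<omega> \<le> birkhoff_max f n \<omega>"
proof (induction n arbitrary: \<omega>)
  case (Suc n)
  show ?case using Suc[of "\<tau> \<omega>"] by (simp add: birkhoff_sum_Suc)
qed simp

lemma birkhoff_max_measurable [measurable]:
  assumes [measurable]: "f \<in> borel_measurable M"
  shows "birkhoff_max f n \<in> borel_measurable M"
proof (induction n)
  case 0
  then show ?case by (simp cong: measurable_cong)
next
  case (Suc n)
  note [measurable] = Suc
  show ?case by (simp add: birkhoff_max.simps(2)[abs_def])
qed

lemma birkhoff_max_bounded:
  assumes "\<And>\<omega>. \<bar>f \<omega>\<bar> \<le> C" shows "birkhoff_max f n \<omega> \<le> real n * C"
proof (induction n arbitrary: \<omega>)
  case (Suc n)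
  have "0 \<le> C" using assms[of \<omega>] by linarith
  then show ?case using Suc[of "\<tau> \<omega>"] assms[of \<omega>] by (auto simp: algebra_simps abs_le_iff)
qed simp

text \<open>Garsia's argument. Where \<open>F (Suc n)\<close> is positive, it equals
  \<open>f\<close> plus \<open>F n\<close> at the image point, which is at most
  \<open>F (Suc n)\<close> there; elsewhere it is 0. After integration the two
  \<open>F (Suc n)\<close> terms cancel by invariance, and \<open>P n\<close> increases to a set of
  full measure.\<close>

lemma maximal_ergodic:
  assumes [measurable]: "f \<in> borel_measurable M" and bound: "\<And>\<omega>. \<bar>f \<omega>\<bar> \<le> C"
    and pos: "AE \<omega> in M. \<exists>n. birkhoff_sum f n \<omega> > 0"
  shows "0 \<le> (\<integral>\<omega>. f \<omega> \<partial>M)"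
proof -
  define F where "F = birkhoff_max f"
  have [measurable]: "F n \<in> borel_measurable M" for n by (simp add: F_def)
  define P where "P n = {\<omega> \<in> space M. F n \<omega> > 0}" for n
  have [measurable]: "P n \<in> sets M" for n unfolding P_def by measurable
  have intF: "integrable M (F n)" for n
    by (rule integrable_const_bound[where B = "real n * C"])
      (use birkhoff_max_bounded[OF bound] birkhoff_max_nonneg in \<open>auto simp: F_def\<close>)
  have intf: "integrable M f"
    by (rule integrable_const_bound[where B = C]) (use bound in auto)
  have intFt: "integrable M (\<lambda>\<omega>. F n (\<tau> \<omega>))" for n
    using intF[of n] integrable_distr[OF measurable_map, of "F n"] by (simp add: distr_map)
  have intPf: "integrable M (\<lambda>\<omega>. indicator (P n) \<omega> * f \<omega>)" for n
    by (rule integrable_const_bound[where B = C]) (use bound in \<open>auto simp: indicator_def intro: order_trans[OF abs_ge_zero]\<close>)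
  have nonneg: "0 \<le> (\<integral>\<omega>. indicator (P (Suc n)) \<omega> * f \<omega> \<partial>M)" for n
  proof -
    have "(\<integral>\<omega>. F (Suc n) \<omega> \<partial>M) \<le> (\<integral>\<omega>. indicator (P (Suc n)) \<omega> * f \<omega> + F (Suc n) (\<tau> \<omega>) \<partial>M)"
    proof (rule integral_mono_AE)
      show "AE \<omega> in M. F (Suc n) \<omega> \<le> indicator (P (Suc n)) \<omega> * f \<omega> + F (Suc n) (\<tau> \<omega>)"
      proof (rule AE_I2)
        fix \<omega> assume "\<omega> \<in> space M"
        then show "F (Suc n) \<omega> \<le> indicator (P (Suc n)) \<omega> * f \<omega> + F (Suc n) (\<tau> \<omega>)"
          using birkhoff_max_mono[of f n "\<tau> \<omega>"] birkhoff_max_nonneg[of f "Suc n" "\<tau> \<omega>"]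
          by (auto simp: P_def F_def indicator_def)
      qed
    qed (use intF intFt intPf in auto)
    also have "\<dots> = (\<integral>\<omega>. indicator (P (Suc n)) \<omega> * f \<omega> \<partial>M) + (\<integral>\<omega>. F (Suc n) (\<tau> \<omega>) \<partial>M)"
      by (rule Bochner_Integration.integral_add[OF intPf intFt])
    also have "(\<integral>\<omega>. F (Suc n) (\<tau> \<omega>) \<partial>M) = (\<integral>\<omega>. F (Suc n) \<omega> \<partial>M)"
      using integral_distr[OF measurable_map, of "F (Suc n)"] by (simp add: distr_map)
    finally show ?thesis by simp
  qed
  have "(\<lambda>n. \<integral>\<omega>. indicator (P (Suc n)) \<omega> * f \<omega> \<partial>M) \<longlonglongrightarrow> (\<integral>\<omega>. f \<omega> \<partial>M)"
  proof (rule integral_dominated_convergence[where w = "\<lambda>_. C"])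
    show "AE \<omega> in M. (\<lambda>n. indicator (P (Suc n)) \<omega> * f \<omega>) \<longlonglongrightarrow> f \<omega>"
      using pos AE_space
    proof eventually_elim
      case (elim \<omega>)
      then obtain k where k: "birkhoff_sum f k \<omega> > 0" by blast
      have "\<omega> \<in> P n" if "n \<ge> k" for n
      proof -
        have "F k \<omega> \<le> F n \<omega>"
          using that by (induction rule: dec_induct)
            (auto simp: F_def intro: order_trans[OF _ birkhoff_max_mono] simp del: birkhoff_max.simps)
        then show ?thesis
          using k birkhoff_sum_le_max[of f k \<omega>] elim by (auto simp: P_def F_def)
      qed
      then have "eventually (\<lambda>n. indicator (P (Suc n)) \<omega> * f \<omega> = f \<omega>) sequentially"
        unfolding eventually_sequentially by (intro exI[of _ k]) (auto simp: indicator_def)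
      then show ?case by (rule tendsto_eventually)
    qed
    show "AE \<omega> in M. norm (indicator (P (Suc n)) \<omega> * f \<omega>) \<le> C" for n
      using bound by (auto simp: indicator_def intro: order_trans[OF abs_ge_zero])
  qed auto
  then show ?thesis
    by (rule tendsto_lowerbound) (use nonneg in auto)
qed

text \<open>If the measure were one, some Birkhoff sum of \<open>indicator A - r\<close> would be
  positive almost everywhere, and the maximal inequality would give \<open>prob A - r\<close> \<ge>
  0.\<close>

lemma birkhoff_indicator_upper:
  assumes A [measurable]: "A \<in> sets M" and r: "prob A < r"
  shows "prob {\<omega> \<in> space M. \<exists>n. birkhoff_sum (indicator A) n \<omega> > r * real n} < 1"
proof (rule ccontr)
  define G where "G = {\<omega> \<in> space M. \<exists>n. birkhoff_sum (indicator A) n \<omega> > r * real n}"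
  have [measurable]: "G \<in> sets M" unfolding G_def by measurable
  assume "\<not> prob {\<omega> \<in> space M. \<exists>n. birkhoff_sum (indicator A) n \<omega> > r * real n} < 1"
  then have "prob G = 1" using prob_le_1[of G] unfolding G_def by linarith
  then have AE_G: "AE \<omega> in M. \<omega> \<in> G" by (subst (asm) prob_eq_1) auto
  define f where "f \<omega> = indicator A \<omega> - r" for \<omega>
  have [measurable]: "f \<in> borel_measurable M" unfolding f_def by measurable
  have sum_f: "birkhoff_sum f n \<omega> = birkhoff_sum (indicator A) n \<omega> - r * real n" for n \<omega>
    by (simp add: birkhoff_sum_def f_def sum_subtractf)
  have "(\<integral>\<omega>. f \<omega> \<partial>M) = prob A - r"
    unfolding f_def by (subst Bochner_Integration.integral_diff)
      (auto simp: prob_space less_top[symmetric] intro: integrable_real_indicator)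
  moreover have "0 \<le> (\<integral>\<omega>. f \<omega> \<partial>M)"
  proof (rule maximal_ergodic[where C = "\<bar>r\<bar> + 1"])
    show "AE \<omega> in M. \<exists>n. birkhoff_sum f n \<omega> > 0"
      using AE_G by eventually_elim (auto simp: G_def sum_f)
  qed (auto simp: f_def indicator_def)
  ultimately show False using r by simp
qed

lemma birkhoff_sum_indicator:
  "birkhoff_sum (indicator A) n \<omega> = real (card {k. k < n \<and> (\<tau> ^^ k) \<omega> \<in> A})"
proof -
  have "{..<n} \<inter> {k. (\<tau> ^^ k) \<omega> \<in> A} = {k. k < n \<and> (\<tau> ^^ k) \<omega> \<in> A}" by auto
  then show ?thesis
    unfolding birkhoff_sum_def by (simp add: indicator_def sum.If_cases)
qed

lemma birkhoff_sum_add: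
  "birkhoff_sum f (m + n) \<omega> = birkhoff_sum f m \<omega> + birkhoff_sum f n ((\<tau> ^^ m) \<omega>)"
  by (induction m arbitrary: \<omega>) (simp_all add: birkhoff_sum_Suc funpow_swap1)

text \<open>
  Invariance of the measure turns the average of the measures of \<open>I \<inter> \<tau>\<^sup>-\<^sup>k (- V)\<close> into an
  integral of a Birkhoff sum of \<open>I\<close> over \<open>\<tau>\<^sup>-\<^sup>N (- V)\<close>. The bound thus needs no knowledge
  about \<open>V\<close> beyond its measure.
\<close>

lemma exit_estimate:
  assumes [measurable]: "I \<in> sets M" "V \<in> sets M" "A \<in> sets M" "E \<in> sets M"
    and A: "AE \<omega> in M. \<omega> \<in> A \<longrightarrow> real p \<le> birkhoff_sum (indicator I) (Suc N) \<omega>"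
    and E: "AE \<omega> in M. \<omega> \<in> E \<longrightarrow> \<omega> \<in> I \<and> (\<forall>k\<le>N. (\<tau> ^^ k) \<omega> \<in> V)"
  shows "real p * (prob A - prob V) \<le> real (Suc N) * (prob I - prob E)"
proof -
  define X where "X k = {\<omega> \<in> space M. \<omega> \<in> I \<and> (\<tau> ^^ k) \<omega> \<notin> V}" for k
  have [measurable]: "X k \<in> sets M" for k unfolding X_def by measurable
  \<comment> \<open>Almost all points of \<open>E\<close> lie in \<open>I\<close> and are in
    \<open>V\<close> at time \<open>k\<close>, hence outside \<open>X k\<close>.\<close>
  have X: "prob (X k) \<le> prob I - prob E" if "k \<le> N" for k
  proof -
    have "prob (X k) + prob (I - X k) = prob I"
      by (subst finite_measure_Union[symmetric]) (auto simp: X_def intro: arg_cong[where f = prob])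
    moreover have "prob E \<le> prob (I - X k)"
      by (rule finite_measure_mono_AE) (use E that in \<open>auto simp: X_def elim!: eventually_mono\<close>)
    ultimately show ?thesis by linarith
  qed
  define Y where "Y j = {\<omega> \<in> space M. (\<tau> ^^ j) \<omega> \<in> I \<and> (\<tau> ^^ N) \<omega> \<notin> V}" for j
  have [measurable]: "Y j \<in> sets M" for j unfolding Y_def by measurable
  \<comment> \<open>Pulling back by \<open>N - k\<close> moves the exit from \<open>V\<close> to the
    common time \<open>N\<close> and turns the membership in \<open>I\<close> into a visit at time
    \<open>N - k\<close>.\<close>
  have XY: "prob (X k) = prob (Y (N - k))" if "k \<le> N" for k
  proof -
    have "(\<tau> ^^ k) ((\<tau> ^^ (N - k)) \<omega>) = (\<tau> ^^ N) \<omega>" for \<omega>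
      using that by (metis comp_apply funpow_add le_add_diff_inverse)
    then have "(\<tau> ^^ (N - k)) -` X k \<inter> space M = Y (N - k)"
      using measurable_space[OF measurable_funpow_map] by (auto simp: X_def Y_def)
    then show ?thesis using measure_funpow_vimage[of "X k" "N - k"] by simp
  qed
  define Z where "Z = {\<omega> \<in> space M. (\<tau> ^^ N) \<omega> \<in> V}"
  have [measurable]: "Z \<in> sets M" unfolding Z_def by measurable
  have Z: "prob Z = prob V"
    using measure_funpow_vimage[of V N] by (simp add: Z_def vimage_def Int_def conj_commute)
  have int: "integrable M (indicator B :: 'a \<Rightarrow> real)" if "B \<in> sets M" for B
    using that by (auto simp: less_top[symmetric] intro: integrable_real_indicator)
  have "real p * (prob A - prob V) = (\<integral>\<omega>. real p * (indicator A \<omega> - indicator Z \<omega>) \<partial>M)"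
    by (simp add: Z int Bochner_Integration.integral_diff)
  also have "\<dots> \<le> (\<integral>\<omega>. (\<Sum>j\<le>N. indicator (Y j) \<omega>) \<partial>M)"
  proof (rule integral_mono_AE)
    \<comment> \<open>Outside \<open>Z\<close> the sum of the \<open>Y j\<close> counts all visits
      to \<open>I\<close>, at least \<open>p\<close> almost everywhere on \<open>A\<close>; inside
      \<open>Z\<close> the left-hand side is not positive.\<close>
    show "AE \<omega> in M. real p * (indicator A \<omega> - indicator Z \<omega>) \<le> (\<Sum>j\<le>N. indicator (Y j) \<omega>)"
      using A AE_space
    proof eventually_elim
      case (elim \<omega>)
      have "(\<Sum>j\<le>N. indicator (Y j) \<omega>) = (\<Sum>j\<le>N. indicator I ((\<tau> ^^ j) \<omega>) :: real)" if "\<omega> \<notin> Z"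
        using that elim by (intro sum.cong) (auto simp: Y_def Z_def indicator_def)
      then have "\<omega> \<notin> Z \<Longrightarrow> (\<Sum>j\<le>N. indicator (Y j) \<omega> :: real) = birkhoff_sum (indicator I) (Suc N) \<omega>"
        by (simp add: birkhoff_sum_def lessThan_Suc_atMost)
      moreover have "0 \<le> (\<Sum>j\<le>N. indicator (Y j) \<omega> :: real)" by (intro sum_nonneg) auto
      ultimately show ?case using elim by (auto simp: indicator_def)
    qed
  qed (auto intro!: int integrable_mult_right Bochner_Integration.integrable_diff)
  also have "\<dots> = (\<Sum>j\<le>N. prob (Y j))"
    by (simp add: int Bochner_Integration.integral_sum)
  also have "\<dots> = (\<Sum>k\<le>N. prob (Y (N - k)))"
    by (rule sum.nat_diff_reindex[of "\<lambda>j. prob (Y j)" "Suc N", simplified lessThan_Suc_atMost, simplified, symmetric])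
  also have "\<dots> \<le> (\<Sum>k\<le>N. prob I - prob E)"
    by (intro sum_mono) (use X XY in auto)
  also have "\<dots> = real (Suc N) * (prob I - prob E)" by simp
  finally show ?thesis .
qed

end

section \<open>Consequences of ergodicity\<close>

locale ergodic_map = measure_preserving +
  assumes ergodic_invariant:
    "A \<in> sets M \<Longrightarrow> \<tau> -` A \<inter> space M = A \<Longrightarrow> prob A = 0 \<or> prob A = 1"
begin

text \<open>The points at which the Birkhoff sums are unbounded above form an exactly invariant set.\<close>

lemma AE_birkhoff_sum_bounded:
  assumes [measurable]: "f \<in> borel_measurable M" and bound: "\<And>\<omega>. \<bar>f \<omega>\<bar> \<le> C"
    and neg: "(\<integral>\<omega>. f \<omega> \<partial>M) < 0"
  shows "AE \<omega> in M. \<exists>K::nat. \<forall>n. birkhoff_sum f n \<omega> \<le> real K"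
proof -
  define B where "B = {\<omega> \<in> space M. \<forall>K::nat. \<exists>n. birkhoff_sum f n \<omega> > real K}"
  have B [measurable]: "B \<in> sets M" unfolding B_def by measurable
  have "(\<forall>K::nat. \<exists>n. birkhoff_sum f n (\<tau> \<omega>) > real K) \<longleftrightarrow> (\<forall>K::nat. \<exists>n. birkhoff_sum f n \<omega> > real K)" for \<omega>
  proof -
    \<comment> \<open>The sums at \<omega> and at its image differ by the single term
      \<open>f \<omega>\<close>, of absolute value at most \<open>c\<close>, which does not affect
      unboundedness.\<close>
    obtain c :: nat where c: "\<bar>f \<omega>\<bar> \<le> real c" using real_arch_simple by blast
    show ?thesis
    proof safe
      fix K :: nat
      assume "\<forall>K::nat. \<exists>n. birkhoff_sum f n (\<tau> \<omega>) > real K"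
      then obtain n where "birkhoff_sum f n (\<tau> \<omega>) > real (K + c)" by blast
      then have "birkhoff_sum f (Suc n) \<omega> > real K" using c by (simp add: birkhoff_sum_Suc abs_le_iff)
      then show "\<exists>n. birkhoff_sum f n \<omega> > real K" by blast
    next
      fix K :: nat
      assume "\<forall>K::nat. \<exists>n. birkhoff_sum f n \<omega> > real K"
      then obtain n where n: "birkhoff_sum f n \<omega> > real (K + c)" by blast
      then obtain m where "n = Suc m" by (cases n) auto
      then have "birkhoff_sum f m (\<tau> \<omega>) > real K" using c n by (simp add: birkhoff_sum_Suc abs_le_iff)
      then show "\<exists>n. birkhoff_sum f n (\<tau> \<omega>) > real K" by blast
    qed
  qed
  then have "\<tau> -` B \<inter> space M = B"
    using measurable_space[OF measurable_map] by (auto simp: B_def)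
  then have "prob B = 0 \<or> prob B = 1"
    by (rule ergodic_invariant[OF B])
  moreover have "prob B \<noteq> 1"
  proof
    assume "prob B = 1"
    then have "AE \<omega> in M. \<omega> \<in> B" using prob_eq_1[OF B] by simp
    then have "AE \<omega> in M. \<exists>n. birkhoff_sum f n \<omega> > 0"
      by eventually_elim (auto simp: B_def dest!: spec[of _ 0])
    then show False using maximal_ergodic[OF assms(1) bound] neg by linarith
  qed
  ultimately have "AE \<omega> in M. \<omega> \<notin> B" using prob_eq_0[OF B] by simp
  then show ?thesis using AE_space by eventually_elim (auto simp: B_def not_less)
qed

text \<open>For \<open>c'\<close> strictly between \<open>c\<close> and \<open>prob A\<close>, the
  function \<open>c' - indicator A\<close> has negative mean, so outside a set of measure less than
  \<eta> its Birkhoff sums are bounded by some \<open>K\<close>. At a late enough time the surplus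
  \<open>(c' - c) * real (Suc n)\<close> absorbs \<open>K\<close>.\<close>

lemma birkhoff_indicator_lower:
  assumes A [measurable]: "A \<in> sets M" and c: "c < prob A" and \<eta>: "\<eta> > 0"
  shows "\<exists>n. prob {\<omega> \<in> space M. birkhoff_sum (indicator A) (Suc n) \<omega> \<ge> c * real (Suc n)} > 1 - \<eta>"
proof -
  define c' where "c' = (c + prob A) / 2"
  have c': "c < c'" "c' < prob A" using c by (auto simp: c'_def field_simps)
  define f where "f \<omega> = c' - indicator A \<omega>" for \<omega>
  have [measurable]: "f \<in> borel_measurable M" unfolding f_def by measurable
  have sum_f: "birkhoff_sum f n \<omega> = c' * real n - birkhoff_sum (indicator A) n \<omega>" for n \<omega>
    by (simp add: birkhoff_sum_def f_def sum_subtractf)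
  have intf: "(\<integral>\<omega>. f \<omega> \<partial>M) = c' - prob A"
    unfolding f_def by (subst Bochner_Integration.integral_diff)
      (auto simp: prob_space less_top[symmetric] intro: integrable_real_indicator)
  have "AE \<omega> in M. \<exists>K::nat. \<forall>n. birkhoff_sum f n \<omega> \<le> real K"
    by (rule AE_birkhoff_sum_bounded[where C = "\<bar>c'\<bar> + 1"])
      (use c' intf in \<open>auto simp: f_def indicator_def\<close>)
  define D where "D K = {\<omega> \<in> space M. \<forall>n. birkhoff_sum f n \<omega> \<le> real K}" for K :: nat
  have D [measurable]: "D K \<in> sets M" for K unfolding D_def by measurable
  have "incseq D" by (rule incseq_SucI) (auto simp: D_def intro: order_trans)
  then have "(\<lambda>K. prob (D K)) \<longlonglongrightarrow> prob (\<Union>K. D K)"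
    by (rule finite_Lim_measure_incseq[rotated]) (auto simp: D)
  moreover have "prob (\<Union>K. D K) = 1"
  proof (rule prob_eq_1[THEN iffD2])
    show "AE \<omega> in M. \<omega> \<in> (\<Union>K. D K)"
      using \<open>AE \<omega> in M. \<exists>K::nat. _ \<omega> K\<close> AE_space by eventually_elim (auto simp: D_def)
  qed auto
  ultimately have "eventually (\<lambda>K. prob (D K) > 1 - \<eta>) sequentially"
    using \<eta> by (intro order_tendstoD) auto
  then obtain K where K: "prob (D K) > 1 - \<eta>" by (auto simp: eventually_sequentially)
  obtain n :: nat where n: "real K / (c' - c) \<le> real n" using real_arch_simple by blast
  have n': "real K \<le> (c' - c) * real (Suc n)"
    using n c' by (simp add: field_simps)
  have "D K \<subseteq> {\<omega> \<in> space M. birkhoff_sum (indicator A) (Suc n) \<omega> \<ge> c * real (Suc n)}"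
  proof
    fix \<omega> assume "\<omega> \<in> D K"
    then have "\<omega> \<in> space M" "birkhoff_sum f (Suc n) \<omega> \<le> real K" by (auto simp: D_def simp del: of_nat_Suc)
    then show "\<omega> \<in> {\<omega> \<in> space M. birkhoff_sum (indicator A) (Suc n) \<omega> \<ge> c * real (Suc n)}"
      using n' unfolding sum_f left_diff_distrib by simp
  qed
  then have "prob (D K) \<le> prob {\<omega> \<in> space M. birkhoff_sum (indicator A) (Suc n) \<omega> \<ge> c * real (Suc n)}"
    by (intro finite_measure_mono) auto
  then show ?thesis using K by (intro exI[of _ n]) linarith
qed

end

section \<open>Effective null sets\<close>

lemma sets_borel_coordinate: "{\<omega> :: cantor. \<omega> i = b} \<in> sets borel"
proof -
  have "open ((\<lambda>\<omega> :: cantor. \<omega> i) -` {b})"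
  proof (rule open_vimage[OF _ continuous_on_product_coordinates])
    \<comment> \<open>The topology on \<open>bool\<close> is the order topology, in which both
      singletons are open rays.\<close>
    have "{b} = (if b then {False<..} else {..<True})" by auto
    then show "open {b}" by (metis open_greaterThan open_lessThan)
  qed
  then show ?thesis by (simp add: vimage_def)
qed

lemma sets_borel_cyl: "cyl x \<in> sets borel"
  using sets.sets_Collect_finite_All[of "{..<length x}" borel "\<lambda>i \<omega>. \<omega> i = x ! i"] sets_borel_coordinate
  by (simp add: cyl_def)

text \<open>With computable \<open>q\<close>, this is the form in which effectively open sets are
  handled: a decidable property of prefixes, mostly one that persists under extension, instead of an
  enumeration of strings.\<close>

definition string_open :: "(bool list \<Rightarrow> bool) \<Rightarrow> cantor set" where
  "string_open q = {\<omega>. \<exists>n. q (initial \<omega> n)}"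

lemma finite_strings: "finite {y :: bool list. length y = n \<and> P y}"
  using finite_lists_length_eq[of "UNIV :: bool set" n] by (auto intro: finite_subset[rotated])

lemma clopen_eq_UN_cyl: "{\<omega>. P (initial \<omega> n)} = (\<Union>y\<in>{y. length y = n \<and> P y}. cyl y)"
  by (auto simp: cyl_iff_initial)

lemma sets_borel_clopen: "{\<omega>. P (initial \<omega> n)} \<in> sets borel"
  unfolding clopen_eq_UN_cyl by (intro sets.finite_UN finite_strings sets_borel_cyl)

lemma sets_borel_string_open: "string_open q \<in> sets borel"
proof -
  have "string_open q = (\<Union>n. {\<omega>. q (initial \<omega> n)})" by (auto simp: string_open_def)
  then show ?thesis using sets_borel_clopen by auto
qed

lemma cyl_subset: "prefix x y \<Longrightarrow> cyl y \<subseteq> cyl x"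
  by (auto simp: cyl_def prefix_def nth_append)

lemma cyl_Nil [simp]: "cyl [] = UNIV"
  by (simp add: cyl_def)

lemma cyl_Int_nonempty: "\<omega> \<in> cyl x \<Longrightarrow> \<omega> \<in> cyl y \<Longrightarrow> length x \<le> length y \<Longrightarrow> prefix x y"
  by (metis cyl_iff_initial prefix_initial)

text \<open>With \<open>x = 1 / real (Suc m)\<close>, this follows from (1 - x) (1 + x) \<le> 1 and
  Bernoulli's inequality for powers of 1 + x. It gives an explicit number of rounds after which a
  test has reached a prescribed measure.\<close>

lemma power_le_inverse: "(1 - 1 / real (Suc m)) ^ (Suc m * b) \<le> 1 / (1 + real b)"
proof -
  define x where "x = 1 / real (Suc m)"
  have x: "0 < x" "x \<le> 1" by (auto simp: x_def)
  have "((1 - x) * (1 + x)) ^ (Suc m * b) \<le> 1"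
    by (rule power_le_one) (use x in \<open>auto simp: algebra_simps intro: mult_le_one\<close>)
  then have "(1 - x) ^ (Suc m * b) * (1 + x) ^ (Suc m * b) \<le> 1"
    by (simp only: power_mult_distrib)
  moreover have "1 + real b \<le> (1 + x) ^ (Suc m * b)"
  proof -
    have "1 + real (Suc m * b) * x \<le> (1 + x) ^ (Suc m * b)"
      using x by (intro Bernoulli_inequality) auto
    moreover have "real (Suc m * b) * x = real b" unfolding of_nat_mult by (simp add: x_def del: of_nat_Suc)
    ultimately show ?thesis by simp
  qed
  ultimately have "(1 - x) ^ (Suc m * b) * (1 + real b) \<le> 1"
    using x by (meson mult_left_mono order_trans zero_le_power diff_ge_0_iff_ge)
  then show ?thesis unfolding x_def by (simp add: pos_le_divide_eq)
qed

locale cantor_measure = prob_space \<mu> for \<mu> :: "cantor measure" +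
  assumes sets_eq: "sets \<mu> = sets borel" and computable_measure: "computable_measure \<mu>"
begin

lemma space_eq [simp]: "space \<mu> = UNIV"
  using sets_eq_imp_space_eq[OF sets_eq] by simp

lemma sets_cyl [measurable, simp]: "cyl x \<in> sets \<mu>"
  by (simp add: sets_eq sets_borel_cyl)

lemma sets_string_open [measurable, simp]: "string_open q \<in> sets \<mu>"
  by (simp add: sets_eq sets_borel_string_open)

lemma sets_clopen [measurable, simp]: "{\<omega>. P (initial \<omega> n)} \<in> sets \<mu>"
  by (simp add: sets_eq sets_borel_clopen)

lemma prob_clopen: "prob {\<omega>. P (initial \<omega> n)} = (\<Sum>y\<in>{y. length y = n \<and> P y}. prob (cyl y))"
  unfolding clopen_eq_UN_cyl
  by (rule finite_measure_finite_Union) (auto simp: finite_strings disjoint_family_on_def cyl_iff_initial)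

text \<open>Scaling and rounding turn the rational approximations into natural numbers, so that
  certificates become inequalities in \<open>nat\<close>. Of the error 2, one unit comes from the
  tolerance 1/(M + 1) and one from rounding down.\<close>

lemma measure_approximation:
  obtains h :: "bool list \<Rightarrow> nat \<Rightarrow> nat"
  where "computable (\<lambda>p. h (fst p) (snd p))"
    "\<And>x M. \<bar>real (h x M) - real (Suc M) * prob (cyl x)\<bar> \<le> 2"
proof -
  obtain f where f: "recursive 2 f" "\<And>x \<epsilon>. \<epsilon> > 0 \<Longrightarrow> \<exists>q. f [str_code x, rat_code \<epsilon>] = rat_code q
      \<and> \<bar>prob (cyl x) - real_of_rat q\<bar> \<le> real_of_rat \<epsilon>"
    using computable_measure unfolding computable_measure_def by blast
  define c where "c x M = f [enc x, enc (int_encode 1, Suc M)]" for x :: "bool list" and M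
  define num where "num x M = fst (prod_decode (c x M))" for x M
  define den where "den x M = snd (prod_decode (c x M))" for x M
  \<comment> \<open>A numerator \<open>a\<close> \<ge> 0 has the code \<open>2 * a\<close>, negative
    ones have odd codes. A negative approximation is replaced by 0.\<close>
  define h where "h x M = (if odd (num x M) then 0 else (Suc M * (num x M div 2)) div den x M)" for x M
  have "computable (\<lambda>p. h (fst p) (snd p))"
    unfolding h_def num_def den_def c_def by (intro computable_intros computable_recursive2[OF f(1)])
  moreover have "\<bar>real (h x M) - real (Suc M) * prob (cyl x)\<bar> \<le> 2" for x M
  proof -
    define \<epsilon> where "\<epsilon> = Fract 1 (int (Suc M))"
    have \<epsilon>: "\<epsilon> > 0" "real_of_rat \<epsilon> = 1 / real (Suc M)"
      by (auto simp: \<epsilon>_def zero_less_Fract_iff of_rat_rat)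
    have "quotient_of \<epsilon> = (1, int (Suc M))"
      unfolding \<epsilon>_def quotient_of_Fract by (simp add: Rat.normalize_def)
    then have "rat_code \<epsilon> = enc (int_encode 1, Suc M)"
      by (simp add: rat_code_def enc_prod_def del: of_nat_Suc)
    then obtain q where q: "c x M = rat_code q" "\<bar>prob (cyl x) - real_of_rat q\<bar> \<le> 1 / real (Suc M)"
      using f(2)[OF \<epsilon>(1), of x] \<epsilon>(2) by (auto simp: c_def str_code_enc)
    obtain a b where ab: "quotient_of q = (a, b)" by (cases "quotient_of q")
    have b: "b > 0" using ab by (rule quotient_of_denom_pos)
    have qr: "real_of_rat q = real_of_int a / real_of_int b"
      using quotient_of_div[OF ab] by (simp add: of_rat_divide)
    have nd: "num x M = int_encode a" "den x M = nat b"
      using q(1) ab by (auto simp: num_def den_def rat_code_def)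
    define t where "t = real (Suc M) * real_of_rat q"
    have "\<bar>real (Suc M) * (prob (cyl x) - real_of_rat q)\<bar> \<le> 1"
      using q(2) by (simp add: abs_mult pos_le_divide_eq mult.commute del: of_nat_Suc)
    then have t: "\<bar>real (Suc M) * prob (cyl x) - t\<bar> \<le> 1"
      by (simp add: t_def right_diff_distrib del: of_nat_Suc)
    show ?thesis
    proof (cases "a \<ge> 0")
      case True
      then have "h x M = (Suc M * nat a) div nat b"
        by (simp add: h_def nd int_encode_def sum_encode_def)
      then have "real (h x M) = of_int \<lfloor>real (Suc M * nat a) / real (nat b)\<rfloor>"
        by (simp only: floor_divide_of_nat_eq of_int_of_nat_eq)
      also have "real (Suc M * nat a) / real (nat b) = t"
        using True b by (simp add: t_def qr algebra_simps)
      finally have "real (h x M) = of_int \<lfloor>t\<rfloor>" .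
      then have "real (h x M) \<le> t" "t < real (h x M) + 1" by linarith+
      then show ?thesis using t by linarith
    next
      case False
      then have "h x M = 0"
        by (simp add: h_def nd int_encode_def sum_encode_def)
      moreover have "t \<le> 0"
        unfolding t_def qr using False b by (intro mult_nonneg_nonpos divide_nonpos_pos) auto
      moreover have "0 \<le> real (Suc M) * prob (cyl x)" by simp
      ultimately show ?thesis using t by simp
    qed
  qed
  ultimately show ?thesis by (rule that)
qed

text \<open>
  The relation between \<open>x\<close> and the minimal \<open>y\<close> with \<open>Q s x y\<close>, for the first certificate \<open>s\<close>
  of \<open>x\<close>, loses a constant factor of measure with each iteration, so a random sequence cannot
  follow it forever.
\<close>

lemma mlrandom_tree_test:
  assumes cert: "computable (\<lambda>p. cert (fst p) (snd p))"
    and Q: "computable (\<lambda>p. Q (fst p) (fst (snd p)) (snd (snd p)))"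
    and mono: "\<And>s x y z. Q s x y \<Longrightarrow> prefix y z \<Longrightarrow> Q s x z"
    and ext: "\<And>s x y. Q s x y \<Longrightarrow> prefix x y"
    and bound: "\<And>s x. cert x s \<Longrightarrow> prob (string_open (Q s x)) \<le> (1 - 1 / real (Suc m)) * prob (cyl x)"
    and random: "mlrandom \<mu> \<omega>"
  obtains n where "(\<forall>s :: nat. \<not> cert (initial \<omega> n) s) \<or>
    (\<exists>s. cert (initial \<omega> n) s \<and> \<omega> \<notin> string_open (Q s (initial \<omega> n)))"
proof -
  define r where "r = 1 - 1 / real (Suc m)"
  have r: "0 \<le> r" "r < 1" by (auto simp: r_def)
  \<comment> \<open>Fixing the first certificate makes \<open>s\<close> unique for \<open>x\<close>,
    so the successors of \<open>x\<close> are pairwise incomparable and their cylinders disjoint. By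
    monotonicity of \<open>Q\<close>, minimality of \<open>y\<close> needs a test of only the prefix
    one bit shorter; the empty string is exempt because \<open>take\<close> would return it
    unchanged.\<close>
  define D where "D s x y \<longleftrightarrow> (cert x s \<and> (\<forall>t<s. \<not> cert x t)) \<and>
    Q s x y \<and> \<not> (y \<noteq> [] \<and> Q s x (take (length y - 1) y))" for s x y
  define R where "R x y \<longleftrightarrow> (\<exists>s. D s x y)" for x y
  have D_unique: "s = s'" if "D s x y" "D s' x y'" for s s' x y y'
    using that unfolding D_def by (metis nat_neq_iff)
  have R_disjoint: "y = y'" if "R x y" "R x y'" "\<alpha> \<in> cyl y" "\<alpha> \<in> cyl y'" for x y y' \<alpha>
  proof -
    have *: "y = y'" if R: "R x y" "R x y'" and le: "prefix y y'" for y y'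
    proof (rule ccontr)
      assume "y \<noteq> y'"
      with le have "y' \<noteq> []" "prefix y (take (length y' - 1) y')"
        by (cases y' rule: rev_cases; simp)+
      moreover obtain s where "D s x y" "D s x y'"
        using R D_unique unfolding R_def by metis
      ultimately show False using mono unfolding D_def by blast
    qed
    show ?thesis
      using *[of y y'] *[of y' y] that cyl_Int_nonempty[of \<alpha> y y'] cyl_Int_nonempty[of \<alpha> y' y]
      by (metis nat_le_linear)
  qed
  have R_prefix: "prefix x y" if "R x y" for x y
    using that ext unfolding R_def D_def by blast
  have R_exists: "\<exists>n. R x (initial \<alpha> n)" if c: "cert x s" and q: "\<And>s. cert x s \<Longrightarrow> \<alpha> \<in> string_open (Q s x)" for x \<alpha> s
  proof -
    define s where "s = (LEAST s. cert x s)"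
    have s: "cert x s" "\<forall>t<s. \<not> cert x t"
      unfolding s_def using LeastI[of "cert x", OF c] not_less_Least by blast+
    obtain k where "Q s x (initial \<alpha> k)" using q[OF s(1)] by (auto simp: string_open_def)
    define n where "n = (LEAST n. Q s x (initial \<alpha> n))"
    have n: "Q s x (initial \<alpha> n)" "\<forall>t<n. \<not> Q s x (initial \<alpha> t)"
      unfolding n_def
      using LeastI[of "\<lambda>n. Q s x (initial \<alpha> n)", OF \<open>Q s x (initial \<alpha> k)\<close>]
        not_less_Least[of _ "\<lambda>n. Q s x (initial \<alpha> n)"] by blast+
    have "D s x (initial \<alpha> n)"
      using s n by (auto simp: D_def min_def simp flip: length_0_conv)
    then show ?thesis unfolding R_def by blast
  qed
  have R_measure: "emeasure \<mu> (\<Union>y\<in>{y. R x y}. cyl y) \<le> ennreal r * emeasure \<mu> (cyl x)" for x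
  proof (cases "\<exists>y. R x y")
    case True
    then obtain y s where s: "D s x y" unfolding R_def by blast
    have "(\<Union>y\<in>{y. R x y}. cyl y) \<subseteq> string_open (Q s x)"
    proof
      fix \<alpha> assume "\<alpha> \<in> (\<Union>y\<in>{y. R x y}. cyl y)"
      then obtain z where z: "R x z" "\<alpha> \<in> cyl z" by blast
      then have "D s x z" using s D_unique unfolding R_def by metis
      then have "Q s x (initial \<alpha> (length z))" using z by (simp add: D_def cyl_iff_initial)
      then show "\<alpha> \<in> string_open (Q s x)" unfolding string_open_def by blast
    qed
    then have "emeasure \<mu> (\<Union>y\<in>{y. R x y}. cyl y) \<le> ennreal (prob (string_open (Q s x)))"
      unfolding emeasure_eq_measure[symmetric] by (intro emeasure_mono) auto
    also have "\<dots> \<le> ennreal (r * prob (cyl x))"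
      using bound s unfolding D_def r_def by (intro ennreal_leI) blast
    also have "\<dots> = ennreal r * emeasure \<mu> (cyl x)"
      using r by (simp add: ennreal_mult' emeasure_eq_measure)
    finally show ?thesis .
  qed simp
  \<comment> \<open>\<open>G j x\<close> consists of the points that can be followed for
    \<open>j\<close> rounds from \<open>x\<close>. Its measure is the sum over the disjoint
    cylinders of the successors, which yields one factor \<open>r\<close> per round.\<close>
  define G where "G j x = (\<Union>y\<in>{y. (R ^^ j) x y}. cyl y)" for j x
  have G_sets [measurable]: "G j x \<in> sets \<mu>" for j x unfolding G_def by auto
  have G_sub: "G j x \<subseteq> cyl x" for j x
  proof -
    have "prefix x y" if "(R ^^ j) x y" for y
      using that by (induction j arbitrary: y)
        (auto intro: prefix_order.trans R_prefix)
    then show ?thesis unfolding G_def using cyl_subset by fastforce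
  qed
  have G_Suc: "G (Suc j) x = (\<Union>y\<in>{y. R x y}. G j y)" for j x
  proof -
    have "(R ^^ Suc j) x z \<longleftrightarrow> (\<exists>y. R x y \<and> (R ^^ j) y z)" for z
      using relpowp_Suc_D2[of j R x z] relpowp_Suc_I2[of R x _ j z] by blast
    then show ?thesis unfolding G_def by blast
  qed
  have disj: "disjoint_family_on F {y. R x y}" if "\<And>y. F y \<subseteq> cyl y" for F x
    unfolding disjoint_family_on_def using R_disjoint that by blast
  have G_measure: "emeasure \<mu> (G j x) \<le> ennreal (r ^ j) * emeasure \<mu> (cyl x)" for j x
  proof (induction j arbitrary: x)
    case 0
    then show ?case by (simp add: G_def)
  next
    case (Suc j)
    have "emeasure \<mu> (G (Suc j) x) = (\<integral>\<^sup>+y. emeasure \<mu> (G j y) \<partial>count_space {y. R x y})"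
      unfolding G_Suc by (rule emeasure_UN_countable) (auto intro!: disj[OF G_sub])
    also have "\<dots> \<le> (\<integral>\<^sup>+y. ennreal (r ^ j) * emeasure \<mu> (cyl y) \<partial>count_space {y. R x y})"
      by (rule nn_integral_mono) (rule Suc)
    also have "\<dots> = ennreal (r ^ j) * (\<integral>\<^sup>+y. emeasure \<mu> (cyl y) \<partial>count_space {y. R x y})"
      by (rule nn_integral_cmult) auto
    also have "(\<integral>\<^sup>+y. emeasure \<mu> (cyl y) \<partial>count_space {y. R x y}) = emeasure \<mu> (\<Union>y\<in>{y. R x y}. cyl y)"
      by (rule emeasure_UN_countable[symmetric]) (auto intro!: disj[of cyl])
    also have "ennreal (r ^ j) * \<dots> \<le> ennreal (r ^ j) * (ennreal r * emeasure \<mu> (cyl x))"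
      by (rule mult_left_mono[OF R_measure]) simp
    also have "\<dots> = ennreal (r ^ Suc j) * emeasure \<mu> (cyl x)"
      using r by (simp add: ennreal_mult mult_ac)
    finally show ?case .
  qed
  then have G_prob: "prob (G j []) \<le> r ^ j" for j
    using G_measure[of j "[]"] r by (simp add: emeasure_eq_measure prob_space[simplified])
  \<comment> \<open>A number is read as a certificate paired with a string; \<open>map odd\<close>
    accepts every list of numbers, so no number is malformed.\<close>
  define str :: "nat \<Rightarrow> bool list" where "str w = map odd (list_decode (snd (prod_decode w)))" for w
  \<comment> \<open>The flag records whether all rounds so far were correct.\<close>
  define follow where "follow p w = (str w, snd p \<and> D (fst (prod_decode w)) (fst p) (str w))" for p w
  define chain :: "nat \<Rightarrow> nat list" where "chain z = list_decode (snd (prod_decode z))" for z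
  \<comment> \<open>The first component of \<open>z\<close> stands for the code of \<epsilon>, whose
    second component is the denominator \<open>b\<close>. Since \<epsilon> \<ge> 1/b,
    \<open>Suc m * b\<close> rounds suffice: they leave measure at most 1/(1 + b) by
    \<open>power_le_inverse\<close>.\<close>
  define P where "P z \<longleftrightarrow> length (chain z) = Suc m * snd (prod_decode (fst (prod_decode z))) \<and>
    snd (foldl follow ([], True) (chain z))" for z
  define g where "g z = enc (fst (prod_decode z), fst (foldl follow ([], True) (chain z)))" for z
  define W where "W = g ` {z. P z}"
  have D: "computable (\<lambda>p. D (fst p) (fst (snd p)) (snd (snd p)))"
    unfolding D_def by (intro computable_intros computable_compose2[OF cert] computable_compose3[OF Q])
  have follow: "computable (\<lambda>p. follow (fst p) (snd p))"
    unfolding follow_def str_def by (intro computable_intros computable_compose3[OF D])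
  have "comp_enum W"
    unfolding W_def
    by (rule comp_enum_image; unfold P_def g_def chain_def)
      (intro computable_intros computable_compose2[OF follow])+
  have chain_iff: "(R ^^ j) x y \<longleftrightarrow> (\<exists>ws. length ws = j \<and> foldl follow (x, True) ws = (y, True))" for j x y
  proof (induction j arbitrary: y)
    case (Suc j)
    have step: "D s x' y \<longleftrightarrow> (\<exists>w. follow (x', True) w = (y, True) \<and> fst (prod_decode w) = s)" for s x'
    proof
      assume "D s x' y"
      then show "\<exists>w. follow (x', True) w = (y, True) \<and> fst (prod_decode w) = s"
        by (intro exI[of _ "prod_encode (s, list_encode (map of_bool y))"])
          (simp add: follow_def str_def comp_def)
    qed (auto simp: follow_def)
    have "(R ^^ Suc j) x y \<longleftrightarrow> (\<exists>x' w. (R ^^ j) x x' \<and> follow (x', True) w = (y, True))"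
      using step by (auto simp: relcompp.simps R_def)
    also have "\<dots> \<longleftrightarrow> (\<exists>ws w. length ws = j \<and> foldl follow (x, True) (ws @ [w]) = (y, True))"
    proof -
      have "foldl follow (x, True) (ws @ [w]) = (y, True)
        \<longleftrightarrow> (\<exists>x'. foldl follow (x, True) ws = (x', True) \<and> follow (x', True) w = (y, True))" for ws w
        by (cases "foldl follow (x, True) ws") (auto simp: follow_def)
      then show ?thesis unfolding Suc.IH by blast
    qed
    also have "\<dots> \<longleftrightarrow> (\<exists>ws. length ws = Suc j \<and> foldl follow (x, True) ws = (y, True))"
      by (metis length_append_singleton length_Suc_conv_rev)
    finally show ?case .
  qed auto
  have W_iff: "prod_encode (e, str_code y) \<in> W \<longleftrightarrow> (R ^^ (Suc m * snd (prod_decode e))) [] y" for e y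
  proof -
    have "prod_encode (e, str_code y) \<in> W \<longleftrightarrow> (\<exists>z. P z \<and> enc (e, y) = g z)"
      by (auto simp: W_def str_code_enc enc_prod_def image_iff)
    also have "\<dots> \<longleftrightarrow> (\<exists>z. P z \<and> e = fst (prod_decode z) \<and> y = fst (foldl follow ([], True) (chain z)))"
      by (simp add: g_def)
    also have "\<dots> \<longleftrightarrow> (\<exists>ws. length ws = Suc m * snd (prod_decode e) \<and> foldl follow ([], True) ws = (y, True))"
    proof safe
      fix z assume "P z"
      then show "\<exists>ws. length ws = Suc m * snd (prod_decode (fst (prod_decode z)))
        \<and> foldl follow ([], True) ws = (fst (foldl follow ([], True) (chain z)), True)"
        by (intro exI[of _ "chain z"]) (auto simp: P_def prod_eq_iff)
    next
      fix ws assume ws: "length ws = Suc m * snd (prod_decode e)" "foldl follow ([], True) ws = (y, True)"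
      then show "\<exists>z. P z \<and> e = fst (prod_decode z) \<and> y = fst (foldl follow ([], True) (chain z))"
        by (intro exI[of _ "prod_encode (e, list_encode ws)"]) (simp add: P_def chain_def)
    qed
    also have "\<dots> \<longleftrightarrow> (R ^^ (Suc m * snd (prod_decode e))) [] y"
      by (simp only: chain_iff)
    finally show ?thesis .
  qed
  define N where "N = (\<Inter>j. G j [])"
  have "eff_null \<mu> N"
    unfolding eff_null_def Let_def
  proof (intro exI[of _ W] conjI allI impI \<open>comp_enum W\<close>)
    fix \<epsilon> :: rat assume \<epsilon>: "\<epsilon> > 0"
    define b where "b = snd (prod_decode (rat_code \<epsilon>))"
    have V: "(\<Union>x\<in>{x. prod_encode (rat_code \<epsilon>, str_code x) \<in> W}. cyl x) = G (Suc m * b) []"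
      unfolding G_def W_iff b_def ..
    show "N \<subseteq> (\<Union>x\<in>{x. prod_encode (rat_code \<epsilon>, str_code x) \<in> W}. cyl x)"
      unfolding V N_def by blast
    obtain u v where uv: "quotient_of \<epsilon> = (u, v)" by (cases "quotient_of \<epsilon>")
    have v: "v > 0" using uv by (rule quotient_of_denom_pos)
    have \<epsilon>_eq: "\<epsilon> = of_int u / of_int v" using uv by (rule quotient_of_div)
    then have "u > 0" using \<epsilon> v by (simp add: zero_less_divide_iff)
    have "b = nat v" using uv by (simp add: b_def rat_code_def)
    have "prob (G (Suc m * b) []) \<le> 1 / (1 + real b)"
      using G_prob[of "Suc m * b"] power_le_inverse[of m b] unfolding r_def by linarith
    also have "\<dots> \<le> real_of_int u / real_of_int v"
      using \<open>u > 0\<close> v \<open>b = nat v\<close> by (intro frac_le) auto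
    also have "\<dots> = real_of_rat \<epsilon>" by (simp add: \<epsilon>_eq of_rat_divide)
    finally show "measure \<mu> (\<Union>x\<in>{x. prod_encode (rat_code \<epsilon>, str_code x) \<in> W}. cyl x) \<le> real_of_rat \<epsilon>"
      unfolding V .
  qed
  then have "\<omega> \<notin> N" using random unfolding mlrandom_def by blast
  show ?thesis
  proof (rule ccontr)
    assume "\<not> thesis"
    then have never: "(\<exists>s. cert (initial \<omega> n) s) \<and>
        (\<forall>s. cert (initial \<omega> n) s \<longrightarrow> \<omega> \<in> string_open (Q s (initial \<omega> n)))" for n
      using that by blast
    \<comment> \<open>Every prefix reached has a certificate, and \<omega> lies in the open set of
      each of its certificates, so a further round is always possible.\<close>
    have "\<exists>n. (R ^^ j) [] (initial \<omega> n)" for j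
    proof (induction j)
      case 0
      then show ?case by (intro exI[of _ 0]) (simp add: initial_def)
    next
      case (Suc j)
      then obtain n where "(R ^^ j) [] (initial \<omega> n)" by blast
      moreover obtain n' where "R (initial \<omega> n) (initial \<omega> n')"
        using never[of n] R_exists[of "initial \<omega> n"] by blast
      ultimately show ?case by (blast intro: relpowp_Suc_I)
    qed
    then have "\<omega> \<in> N" unfolding N_def G_def by (fastforce simp: cyl_iff_initial)
    then show False using \<open>\<omega> \<notin> N\<close> by simp
  qed
qed

end

section \<open>Effectively open sets as computable predicates on strings\<close>

lemma string_open_initial_mono:
  assumes "\<And>x y. prefix x y \<Longrightarrow> q x \<Longrightarrow> q y" "q (initial \<omega> m)" "m \<le> n"
  shows "q (initial \<omega> n)"
  using assms prefix_initial by blast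

text \<open>\<open>q y\<close> holds if some prefix of \<open>y\<close> is among the first
  \<open>Suc (length y)\<close> enumerated strings. Longer strings allow more enumeration steps and
  have more prefixes, hence monotonicity.\<close>

lemma eff_open_string_open:
  assumes "eff_open U"
  obtains q where "computable q" "\<And>x y. prefix x y \<Longrightarrow> q x \<Longrightarrow> q y" "U = string_open q"
proof -
  obtain S where S: "comp_enum (str_code ` S)" "U = (\<Union>x\<in>S. cyl x)"
    using assms unfolding eff_open_def by blast
  show ?thesis
  proof (cases "S = {}")
    case True
    then show ?thesis
      using that[of "\<lambda>_. False"] S by (auto simp: string_open_def computable_const)
  next
    case False
    then obtain f where f: "recursive 1 f" "str_code ` S = range (\<lambda>n. f [n])"
      using S(1) unfolding comp_enum_def by blast
    define q where "q y \<longleftrightarrow> (\<exists>i<Suc (length y). \<exists>l<Suc (length y). f [i] = enc (take l y))" for y :: "bool list"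
    have 1: "computable q"
      unfolding q_def[abs_def] by (intro computable_intros computable_recursive1[OF f(1)])
    have 2: "q y" if xy: "prefix x y" and qx: "q x" for x y
    proof -
      obtain i l where il: "i < Suc (length x)" "l < Suc (length x)" "f [i] = enc (take l x)"
        using qx unfolding q_def by blast
      moreover have "take l y = take l x"
        using xy il(2) by (auto simp: prefix_def)
      ultimately show ?thesis
        using prefix_length_le[OF xy] unfolding q_def by (intro exI[of _ i] conjI exI[of _ l]) auto
    qed
    have 3: "U = string_open q"
    proof (intro set_eqI iffI)
      fix \<omega> assume "\<omega> \<in> U"
      then obtain x where x: "x \<in> S" "\<omega> \<in> cyl x" using S by blast
      have "str_code x \<in> range (\<lambda>n. f [n])" using x(1) unfolding f(2)[symmetric] by (rule imageI)
      then obtain i where i: "f [i] = enc x" by (auto simp: str_code_enc)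
      have "q (initial \<omega> (max i (length x)))"
        unfolding q_def using i x(2)
        by (intro exI[of _ i] conjI exI[of _ "length x"]) (auto simp: cyl_iff_initial)
      then show "\<omega> \<in> string_open q" unfolding string_open_def by blast
    next
      fix \<omega> assume "\<omega> \<in> string_open q"
      then obtain n i l where nil: "l < Suc n" "f [i] = enc (take l (initial \<omega> n))"
        unfolding string_open_def q_def by (auto simp del: take_initial)
      then have "take l (initial \<omega> n) \<in> S"
      proof -
        have "f [i] \<in> str_code ` S" unfolding f(2) by (rule rangeI)
        then obtain x where "x \<in> S" "f [i] = str_code x" by blast
        then show ?thesis using nil(2) by (simp add: str_code_enc)
      qed
      moreover have "\<omega> \<in> cyl (take l (initial \<omega> n))" by (simp add: cyl_iff_initial)
      ultimately show "\<omega> \<in> U" using S by blast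
    qed
    show ?thesis by (rule that[OF 1 2 3])
  qed
qed

section \<open>Random sequences and open sets of full measure\<close>

context cantor_measure begin

lemma string_open_approximation:
  assumes "\<And>x y. prefix x y \<Longrightarrow> q x \<Longrightarrow> q y"
  shows "(\<lambda>n. prob {\<omega>. q (initial \<omega> n)}) \<longlonglongrightarrow> prob (string_open q)"
proof -
  have "string_open q = (\<Union>n. {\<omega>. q (initial \<omega> n)})" by (auto simp: string_open_def)
  moreover have "incseq (\<lambda>n. {\<omega>. q (initial \<omega> n)})"
    using string_open_initial_mono[of q, OF assms] by (auto simp: incseq_def)
  ultimately show ?thesis by (auto intro: finite_Lim_measure_incseq)
qed

text \<open>If a prefix \<open>x0\<close> of \<omega> had measure 0, then for every \<open>x\<close>
  the common extensions of \<open>x\<close> and \<open>x0\<close> would form a null set containing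
  \<omega> whenever \<open>x\<close> is a prefix of \<omega>. The tree test applies with shrinking
  factor 0 and every number as a certificate.\<close>

lemma mlrandom_cyl_pos:
  assumes "mlrandom \<mu> \<omega>" shows "prob (cyl (initial \<omega> n)) > 0"
proof (rule ccontr)
  define x0 where "x0 = initial \<omega> n"
  assume "\<not> prob (cyl (initial \<omega> n)) > 0"
  then have null: "prob (cyl x0) = 0" using measure_nonneg[of \<mu> "cyl x0"] unfolding x0_def by linarith
  define Q where "Q s x y \<longleftrightarrow> prefix x y \<and> prefix x0 y" for s :: nat and x y
  have sub: "string_open (Q s x) \<subseteq> cyl x0" for s x
    unfolding string_open_def Q_def by (auto simp: prefix_initial_iff)
  show False
  proof (rule mlrandom_tree_test[of "\<lambda>_ _. True" Q 0 \<omega>])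
    show "computable (\<lambda>p. Q (fst p) (fst (snd p)) (snd (snd p)))"
      unfolding Q_def by (intro computable_intros)
    show "Q s x z" if "Q s x y" "prefix y z" for s x y z
      using that unfolding Q_def by (blast intro: prefix_order.trans)
    show "prob (string_open (Q s x)) \<le> (1 - 1 / real (Suc 0)) * prob (cyl x)" for s x
      using finite_measure_mono[OF sub[of s x]] null by simp
    show "False" if "(\<forall>s::nat. \<not> True) \<or> (\<exists>s. True \<and> \<omega> \<notin> string_open (Q s (initial \<omega> k)))" for k
    proof -
      have "Q s (initial \<omega> k) (initial \<omega> (max k n))" for s
        unfolding Q_def x0_def by (simp add: prefix_initial)
      then show False using that unfolding string_open_def by blast
    qed
  qed (auto simp: Q_def computable_const assms)
qed

text \<open>A certificate \<open>(L, M)\<close> shows, with approximations of precision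
  \<open>M\<close>, that the extensions of \<open>x\<close> of length \<open>L\<close> violating
  \<open>q\<close> have at most half the measure of \<open>cyl x\<close>. Full measure provides
  certificates for all prefixes of \<omega>, so the test can only end because \<open>q\<close> holds
  at some prefix.\<close>

lemma mlrandom_in_full_open:
  assumes q: "computable q" and mono: "\<And>x y. prefix x y \<Longrightarrow> q x \<Longrightarrow> q y"
    and full: "prob (string_open q) = 1" and random: "mlrandom \<mu> \<omega>"
  shows "\<omega> \<in> string_open q"
proof -
  obtain h :: "bool list \<Rightarrow> nat \<Rightarrow> nat" where h: "computable (\<lambda>p. h (fst p) (snd p))"
    "\<And>x M. \<bar>real (h x M) - real (Suc M) * prob (cyl x)\<bar> \<le> 2"
    using measure_approximation by blast
  define Bad where "Bad x y \<longleftrightarrow> prefix x y \<and> \<not> q y" for x y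
  define S where "S L x = {y. length y = L \<and> Bad x y}" for L x
  \<comment> \<open>Adding 2 on the left and subtracting 2 on the right turns the approximations
    into safe bounds; truncation at 0 is harmless, as measures are nonnegative.\<close>
  define cert where "cert x s \<longleftrightarrow> length x \<le> fst (prod_decode s) \<and>
    2 * (\<Sum>y\<in>S (fst (prod_decode s)) x. h y (snd (prod_decode s)) + 2) \<le> h x (snd (prod_decode s)) - 2" for x s
  define Q where "Q s x y \<longleftrightarrow> prefix x y \<and> fst (prod_decode s) \<le> length y \<and> \<not> q (take (fst (prod_decode s)) y)" for s x y
  have probS: "(\<Sum>y\<in>S L x. prob (cyl y)) = prob {\<alpha>. Bad x (initial \<alpha> L)}" for L x
    unfolding S_def by (rule prob_clopen[symmetric])
  obtain n where n: "(\<forall>s. \<not> cert (initial \<omega> n) s) \<or>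
    (\<exists>s. cert (initial \<omega> n) s \<and> \<omega> \<notin> string_open (Q s (initial \<omega> n)))"
  proof (rule mlrandom_tree_test[of cert Q 1 \<omega>])
    show "computable (\<lambda>p. cert (fst p) (snd p))"
      unfolding cert_def S_def Bad_def
      by (intro computable_intros computable_compose2[OF h(1)] computable_compose[OF q])
    show "computable (\<lambda>p. Q (fst p) (fst (snd p)) (snd (snd p)))"
      unfolding Q_def by (intro computable_intros computable_compose[OF q])
    show "Q s x z" if "Q s x y" "prefix y z" for s x y z
      using that unfolding Q_def by (auto simp: prefix_def)
    show "prob (string_open (Q s x)) \<le> (1 - 1 / real (Suc 1)) * prob (cyl x)" if "cert x s" for s x
    proof -
      define L M where "L = fst (prod_decode s)" and "M = snd (prod_decode s)"
      have len: "length x \<le> L" and le: "2 * (\<Sum>y\<in>S L x. h y M + 2) \<le> h x M - 2"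
        using that by (auto simp: cert_def L_def M_def)
      have "string_open (Q s x) \<subseteq> {\<alpha>. Bad x (initial \<alpha> L)}"
        using len by (auto simp: string_open_def Q_def Bad_def L_def[symmetric] prefix_initial_iff min_absorb1)
      then have "prob (string_open (Q s x)) \<le> (\<Sum>y\<in>S L x. prob (cyl y))"
        unfolding probS by (intro finite_measure_mono) auto
      then have "real (Suc M) * prob (string_open (Q s x)) \<le> (\<Sum>y\<in>S L x. real (Suc M) * prob (cyl y))"
        unfolding sum_distrib_left[symmetric] by (intro mult_left_mono) auto
      also have "\<dots> \<le> (\<Sum>y\<in>S L x. real (h y M + 2))"
        by (intro sum_mono) (use h(2)[of _ M] in \<open>simp add: abs_le_iff algebra_simps\<close>)
      also have "\<dots> = real (\<Sum>y\<in>S L x. h y M + 2)" by simp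
      finally have "2 * (real (Suc M) * prob (string_open (Q s x))) \<le> real (h x M - 2)"
        using le by linarith
      also have "\<dots> \<le> real (Suc M) * prob (cyl x)"
      proof -
        have "0 \<le> real (Suc M) * prob (cyl x)" by simp
        then show ?thesis using h(2)[of x M] by linarith
      qed
      finally have "real (Suc M) * (2 * prob (string_open (Q s x))) \<le> real (Suc M) * prob (cyl x)"
        by (simp only: mult.left_commute)
      then have "2 * prob (string_open (Q s x)) \<le> prob (cyl x)"
        by (rule mult_left_le_imp_le) simp
      then show ?thesis by simp
    qed
  qed (auto simp: Q_def random)
  define x where "x = initial \<omega> n"
  have pos: "prob (cyl x) > 0" unfolding x_def by (rule mlrandom_cyl_pos[OF random])
  have "1 - prob (cyl x) / 8 < prob (string_open q)" using pos full by linarith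
  then have "eventually (\<lambda>L. prob {\<alpha>. q (initial \<alpha> L)} > 1 - prob (cyl x) / 8) sequentially"
    using order_tendstoD(1)[OF string_open_approximation[of q]] mono by blast
  then have "eventually (\<lambda>L. prob {\<alpha>. q (initial \<alpha> L)} > 1 - prob (cyl x) / 8 \<and> n \<le> L) sequentially"
    using eventually_ge_at_top[of n] by eventually_elim auto
  then obtain L where L: "prob {\<alpha>. q (initial \<alpha> L)} > 1 - prob (cyl x) / 8" "n \<le> L"
    by (auto simp: eventually_sequentially)
  have PS: "(\<Sum>y\<in>S L x. prob (cyl y)) \<le> prob (cyl x) / 8"
  proof -
    have "prob {\<alpha>. Bad x (initial \<alpha> L)} \<le> prob (UNIV - {\<alpha>. q (initial \<alpha> L)})"
      by (intro finite_measure_mono) (auto simp: Bad_def sets.compl_sets[of _ \<mu>, simplified])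
    also have "\<dots> = 1 - prob {\<alpha>. q (initial \<alpha> L)}"
      using prob_compl[of "{\<alpha>. q (initial \<alpha> L)}"] by simp
    finally show ?thesis unfolding probS using L by linarith
  qed
  \<comment> \<open>With t = (M + 1) \<mu> (cyl x) and \<open>c\<close> strings in the sum, the
    certificate follows from 2 (t/8 + 4 c) \<le> t - 4, that is, 8 c + 4 \<le> 3 t/4.\<close>
  obtain M :: nat where M: "(8 * real (card (S L x)) + 4) / (3 / 4 * prob (cyl x)) \<le> real M"
    using real_arch_simple by blast
  then have M': "8 * real (card (S L x)) + 4 \<le> real (Suc M) * (3 / 4 * prob (cyl x))"
    using pos by (simp add: pos_divide_le_eq algebra_simps)
  have "2 * real (\<Sum>y\<in>S L x. h y M + 2) \<le> 2 * (\<Sum>y\<in>S L x. real (Suc M) * prob (cyl y) + 4)"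
    unfolding of_nat_sum
    by (intro mult_left_mono sum_mono) (use h(2)[of _ M] in \<open>auto simp: abs_le_iff algebra_simps\<close>)
  also have "\<dots> = 2 * (real (Suc M) * (\<Sum>y\<in>S L x. prob (cyl y)) + 4 * real (card (S L x)))"
    by (simp only: sum.distrib sum_distrib_left[symmetric] sum_constant mult.commute)
  also have "\<dots> \<le> 2 * (real (Suc M) * (prob (cyl x) / 8) + 4 * real (card (S L x)))"
    by (intro mult_left_mono add_right_mono PS) auto
  also have "\<dots> \<le> real (Suc M) * prob (cyl x) - 4"
  proof -
    have "2 * (t / 8 + 4 * c) \<le> t - 4" if "8 * c + 4 \<le> 3 / 4 * t" for t c :: real
      using that by (simp add: field_simps)
    from this[of "real (card (S L x))" "real (Suc M) * prob (cyl x)"] M' show ?thesis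
      by (simp only: mult.left_commute[of "real (Suc M)"] times_divide_eq_right)
  qed
  also have "\<dots> \<le> real (h x M) - 2" using h(2)[of x M] by linarith
  finally have "2 * (\<Sum>y\<in>S L x. h y M + 2) \<le> h x M - 2" by linarith
  then have "cert x (prod_encode (L, M))" using L by (simp add: cert_def x_def)
  then obtain s where "\<omega> \<notin> string_open (Q s x)" using n x_def by blast
  then have "\<not> Q s x (initial \<omega> (max n (fst (prod_decode s))))" unfolding string_open_def by blast
  then have "q (initial \<omega> (fst (prod_decode s)))"
    by (auto simp: Q_def x_def prefix_initial min_absorb1)
  then show ?thesis unfolding string_open_def by blast
qed

end

section \<open>Orbits of random points\<close>

locale computable_dynamics = cantor_measure +
  fixes T :: "cantor \<Rightarrow> cantor option" and H :: "bool list \<Rightarrow> bool list"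
  assumes computable_H: "computable H"
    and H_mono: "prefix x y \<Longrightarrow> prefix (H x) (H y)"
    and T_iff: "T \<omega> = Some \<alpha> \<longleftrightarrow>
      (\<forall>k. \<exists>l. k < length (H (initial \<omega> l)) \<and> H (initial \<omega> l) ! k = \<alpha> k)"
    and ae_defined: "ae_defined \<mu> T" and preserving: "preserving \<mu> T" and ergodic: "ergodic \<mu> T"
begin

text \<open>Undefined points are made fixed points. They form a null set, so \<tau> inherits
  invariance and ergodicity and can be iterated as a total map.\<close>

definition \<tau> :: "cantor \<Rightarrow> cantor" where
  "\<tau> \<omega> = (case T \<omega> of None \<Rightarrow> \<omega> | Some \<alpha> \<Rightarrow> \<alpha>)"

lemma T_eq: "\<omega> \<in> dom T \<Longrightarrow> T \<omega> = Some (\<tau> \<omega>)"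
  by (auto simp: \<tau>_def)

lemma sets_dom: "dom T \<in> sets \<mu>"
  using ae_defined by (simp add: ae_defined_def)

lemma null_sets_undefined: "- dom T \<in> null_sets \<mu>"
proof (rule null_setsI)
  show sets: "- dom T \<in> sets \<mu>"
    using sets.compl_sets[OF sets_dom] by (simp add: Compl_eq_Diff_UNIV)
  have "prob (dom T) = 1" using ae_defined by (simp add: ae_defined_def measure_def)
  then have "prob (- dom T) = 0"
    using prob_compl[OF sets_dom] by (simp add: Compl_eq_Diff_UNIV)
  then show "emeasure \<mu> (- dom T) = 0" by (simp add: emeasure_eq_measure)
qed

lemma AE_dom: "AE \<omega> in \<mu>. \<omega> \<in> dom T"
  by (rule AE_I'[OF null_sets_undefined]) auto

lemma vimage_\<tau>: "\<tau> -` B = preimage T B \<union> (B - dom T)"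
  by (auto simp: \<tau>_def preimage_def split: option.splits)

lemma sets_preimage: "B \<in> sets \<mu> \<Longrightarrow> preimage T B \<in> sets \<mu>"
  using preserving by (simp add: preserving_def)

lemma measurable_\<tau>: "\<tau> \<in> measurable \<mu> \<mu>"
  by (rule measurableI) (use sets_dom sets_preimage in \<open>auto simp: vimage_\<tau>\<close>)

lemma distr_\<tau>: "distr \<mu> \<mu> \<tau> = \<mu>"
proof (rule measure_eqI)
  fix B assume "B \<in> sets (distr \<mu> \<mu> \<tau>)"
  then have B: "B \<in> sets \<mu>" by simp
  have "emeasure \<mu> (\<tau> -` B) = emeasure \<mu> (preimage T B)"
    unfolding vimage_\<tau>
    by (rule emeasure_Un_null_set[OF sets_preimage[OF B]])
      (rule null_sets_subset[OF null_sets_undefined], use B sets_dom in auto)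
  also have "\<dots> = emeasure \<mu> B" using preserving B by (simp add: preserving_def)
  finally show "emeasure (distr \<mu> \<mu> \<tau>) B = emeasure \<mu> B"
    using emeasure_distr[OF measurable_\<tau> B] by simp
qed simp

sublocale ergodic_map \<mu> \<tau>
proof
  show "\<tau> \<in> measurable \<mu> \<mu>" by (rule measurable_\<tau>)
  show "distr \<mu> \<mu> \<tau> = \<mu>" by (rule distr_\<tau>)
  fix A assume A: "A \<in> sets \<mu>" "\<tau> -` A \<inter> space \<mu> = A"
  \<comment> \<open>A set exactly invariant under \<tau> differs from its preimage under
    \<open>T\<close> only where \<open>T\<close> is undefined.\<close>
  have "sym_diff (preimage T A) A \<subseteq> - dom T"
    using A(2) by (auto simp: vimage_\<tau> preimage_def)
  then have "sym_diff (preimage T A) A \<in> null_sets \<mu>"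
    by (rule null_sets_subset[OF null_sets_undefined, rotated]) (use A sets_preimage in auto)
  then have "emeasure \<mu> A \<in> {0, 1}" using ergodic A unfolding ergodic_def by blast
  then show "prob A = 0 \<or> prob A = 1" by (auto simp: measure_def)
qed

definition regular :: "cantor \<Rightarrow> bool" where
  "regular \<omega> \<longleftrightarrow> (\<forall>k. (\<tau> ^^ k) \<omega> \<in> dom T)"

lemma AE_regular: "AE \<omega> in \<mu>. regular \<omega>"
  unfolding regular_def AE_all_countable by (intro allI AE_funpow AE_dom)

lemma regular_iterate: "regular \<omega> \<Longrightarrow> iterate T k \<omega> = Some ((\<tau> ^^ k) \<omega>)"
proof (induction k)
  case (Suc k)
  then show ?case using T_eq[of "(\<tau> ^^ k) \<omega>"] by (simp add: regular_def)
qed simp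

lemma regular_funpow: "regular \<omega> \<Longrightarrow> regular ((\<tau> ^^ k) \<omega>)"
  unfolding regular_def by (metis comp_apply funpow_add)

section \<open>Following an orbit through finite prefixes\<close>

lemma H_cyl:
  assumes "T \<omega> = Some \<alpha>" shows "\<alpha> \<in> cyl (H (initial \<omega> l))"
  unfolding cyl_def
proof (intro CollectI allI impI)
  fix i assume i: "i < length (H (initial \<omega> l))"
  obtain l' where l': "i < length (H (initial \<omega> l'))" "H (initial \<omega> l') ! i = \<alpha> i"
    using assms T_iff by blast
  have "prefix (H (initial \<omega> l)) (H (initial \<omega> (max l l')))"
    "prefix (H (initial \<omega> l')) (H (initial \<omega> (max l l')))"
    by (auto intro!: H_mono prefix_initial)
  then show "\<alpha> i = H (initial \<omega> l) ! i" using i l' by (metis prefix_nth)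
qed

lemma H_prefix:
  assumes "T \<omega> = Some \<alpha>" shows "\<exists>l. prefix (initial \<alpha> n) (H (initial \<omega> l))"
proof -
  obtain l where "n < length (H (initial \<omega> l))" using assms T_iff by blast
  then have "prefix (initial \<alpha> n) (H (initial \<omega> l))"
    using H_cyl[OF assms, of l] by (metis cyl_iff_initial less_imp_le prefix_initial)
  then show ?thesis ..
qed

lemma funpow_H_mono: "prefix x y \<Longrightarrow> prefix ((H ^^ k) x) ((H ^^ k) y)"
  by (induction k) (auto intro: H_mono)

text \<open>Definedness is assumed only at times before \<open>k\<close>, because
  \<open>mlrandom_regular\<close> uses this in an induction, when later images are not yet known to
  exist.\<close>

lemma funpow_H:
  assumes "\<forall>j<k. (\<tau> ^^ j) \<omega> \<in> dom T"
  shows "(\<forall>l. (\<tau> ^^ k) \<omega> \<in> cyl ((H ^^ k) (initial \<omega> l))) \<and>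
    (\<forall>n. \<exists>l. prefix (initial ((\<tau> ^^ k) \<omega>) n) ((H ^^ k) (initial \<omega> l)))"
  using assms
proof (induction k)
  case 0
  then show ?case by (auto simp: cyl_iff_initial)
next
  case (Suc k)
  define \<beta> where "\<beta> = (\<tau> ^^ k) \<omega>"
  have IH: "\<beta> \<in> cyl ((H ^^ k) (initial \<omega> l))" "\<exists>l. prefix (initial \<beta> n) ((H ^^ k) (initial \<omega> l))" for l n
    using Suc unfolding \<beta>_def by auto
  have T: "T \<beta> = Some (\<tau> \<beta>)" using Suc.prems T_eq[of \<beta>] by (simp add: \<beta>_def)
  have 1: "\<tau> \<beta> \<in> cyl (H ((H ^^ k) (initial \<omega> l)))" for l
    using H_cyl[OF T, of "length ((H ^^ k) (initial \<omega> l))"] IH(1)[of l] by (simp add: cyl_iff_initial)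
  have 2: "\<exists>l. prefix (initial (\<tau> \<beta>) n) (H ((H ^^ k) (initial \<omega> l)))" for n
  proof -
    obtain l1 where "prefix (initial (\<tau> \<beta>) n) (H (initial \<beta> l1))"
      using H_prefix[OF T] by blast
    moreover obtain l where "prefix (initial \<beta> l1) ((H ^^ k) (initial \<omega> l))"
      using IH(2) by blast
    ultimately show ?thesis by (blast intro: prefix_order.trans H_mono)
  qed
  show ?case using 1 2 by (simp add: \<beta>_def)
qed

lemma regular_H_cyl: "regular \<omega> \<Longrightarrow> (\<tau> ^^ k) \<omega> \<in> cyl ((H ^^ k) (initial \<omega> l))"
  and regular_H_prefix: "regular \<omega> \<Longrightarrow> \<exists>l. prefix (initial ((\<tau> ^^ k) \<omega>) n) ((H ^^ k) (initial \<omega> l))"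
  using funpow_H by (auto simp: regular_def)

lemma computable_funpow_H [computable_intros]:
  assumes "computable k" "computable f" shows "computable (\<lambda>x. (H ^^ k x) (f x))"
  by (rule computable_funpow[where h = "\<lambda>_. H", OF assms(1) _ assms(2)])
    (intro computable_compose[OF computable_H] computable_snd computable_id)

lemma funpow_string_open:
  assumes "regular \<omega>" "q ((H ^^ k) (initial \<omega> l))"
  shows "(\<tau> ^^ k) \<omega> \<in> string_open q"
proof -
  have "q (initial ((\<tau> ^^ k) \<omega>) (length ((H ^^ k) (initial \<omega> l))))"
    using regular_H_cyl[OF assms(1), of k l] assms(2) by (simp add: cyl_iff_initial)
  then show ?thesis unfolding string_open_def by blast
qed

text \<open>Each of the finitely many conditions is seen on some prefix of \<omega>, and by
  monotonicity the longest of these shows them all. \<open>K\<close> selects the times, and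
  \<open>l0\<close> allows a long prefix to be demanded.\<close>

lemma string_open_funpow:
  assumes "regular \<omega>" and mono: "\<And>x y. prefix x y \<Longrightarrow> q x \<Longrightarrow> q y"
    and "\<forall>k<n. k \<in> K \<longrightarrow> (\<tau> ^^ k) \<omega> \<in> string_open q"
  shows "\<exists>l\<ge>l0. \<forall>k<n. k \<in> K \<longrightarrow> q ((H ^^ k) (initial \<omega> l))"
  using assms(3)
proof (induction n)
  case (Suc n)
  then obtain l where l: "l \<ge> l0" "\<forall>k<n. k \<in> K \<longrightarrow> q ((H ^^ k) (initial \<omega> l))" by auto
  have "\<exists>l'. n \<in> K \<longrightarrow> q ((H ^^ n) (initial \<omega> l'))"
  proof (cases "n \<in> K")
    case True
    then obtain i where "q (initial ((\<tau> ^^ n) \<omega>) i)" using Suc.prems by (auto simp: string_open_def)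
    then show ?thesis using regular_H_prefix[OF assms(1), of n i] mono by blast
  qed simp
  then obtain l' where l': "n \<in> K \<longrightarrow> q ((H ^^ n) (initial \<omega> l'))" by blast
  have "q ((H ^^ k) (initial \<omega> (max l l')))" if "k < Suc n" "k \<in> K" for k
  proof (cases "k = n")
    case True
    then show ?thesis
      using that l' mono[OF funpow_H_mono[OF prefix_initial[of l' "max l l'"]]] by auto
  next
    case False
    then show ?thesis
      using that l mono[OF funpow_H_mono[OF prefix_initial[of l "max l l'"]]] by auto
  qed
  then show ?case using l(1) by (intro exI[of _ "max l l'"]) auto
qed auto

text \<open>Producing more than \<open>n\<close> bits of the image at time \<open>Suc k\<close> is
  an open condition of full measure, so it holds at \<omega> by
  \<open>mlrandom_in_full_open\<close>. The induction ensures that \<open>H ^^ k\<close> really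
  follows the orbit up to the point whose image is examined.\<close>

lemma mlrandom_regular:
  assumes "mlrandom \<mu> \<omega>" shows "regular \<omega>"
proof -
  have "(\<tau> ^^ k) \<omega> \<in> dom T" for k
  proof (induction k rule: less_induct)
    case (less k)
    define \<beta> where "\<beta> = (\<tau> ^^ k) \<omega>"
    have "\<exists>l. n < length (H (initial \<beta> l))" for n
    proof -
      define q where "q y \<longleftrightarrow> n < length ((H ^^ Suc k) y)" for y
      have "\<omega> \<in> string_open q"
      proof (rule mlrandom_in_full_open)
        show "computable q" unfolding q_def[abs_def] by (intro computable_intros)
        show "q y" if "prefix x y" "q x" for x y
          using funpow_H_mono[OF that(1), of "Suc k"] that(2) unfolding q_def
          by (meson less_le_trans prefix_length_le)
        have "AE \<alpha> in \<mu>. \<alpha> \<in> string_open q"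
          using AE_regular
        proof eventually_elim
          case (elim \<alpha>)
          obtain l where "prefix (initial ((\<tau> ^^ Suc k) \<alpha>) (Suc n)) ((H ^^ Suc k) (initial \<alpha> l))"
            using regular_H_prefix[OF elim] by blast
          then have "q (initial \<alpha> l)" unfolding q_def by (metis Suc_le_lessD length_initial prefix_length_le)
          then show ?case unfolding string_open_def by blast
        qed
        then show "prob (string_open q) = 1" by (subst prob_eq_1) auto
      qed (rule assms)
      then obtain l where "n < length (H ((H ^^ k) (initial \<omega> l)))"
        by (auto simp: string_open_def q_def)
      moreover have "(H ^^ k) (initial \<omega> l) = initial \<beta> (length ((H ^^ k) (initial \<omega> l)))"
        using funpow_H[of k \<omega>] less by (simp add: \<beta>_def cyl_iff_initial)
      ultimately show ?thesis by metis
    qed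
    then obtain l where l: "n < length (H (initial \<beta> (l n)))" for n by metis
    have "T \<beta> = Some (\<lambda>n. H (initial \<beta> (l n)) ! n)"
      unfolding T_iff using l by blast
    then show ?case by (auto simp: \<beta>_def)
  qed
  then show ?thesis by (simp add: regular_def)
qed

text \<open>
  A certificate for \<open>x\<close> is a time \<open>N\<close> at which most points have visited \<open>cyl x\<close> often enough; by
  \<open>exit_estimate\<close>, it guarantees that a fixed proportion of \<open>cyl x\<close> leaves the open set before
  time \<open>N\<close>, although the measure of the part that stays cannot be computed.
\<close>

lemma mlrandom_leaves_open:
  assumes q: "computable q" and mono: "\<And>x y. prefix x y \<Longrightarrow> q x \<Longrightarrow> q y"
    and less: "prob (string_open q) < 1" and random: "mlrandom \<mu> \<omega>"
  shows "\<exists>k. (\<tau> ^^ k) \<omega> \<notin> string_open q"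
proof -
  define V where "V = string_open q"
  have [measurable, simp]: "V \<in> sets \<mu>" by (simp add: V_def)
  \<comment> \<open>The 4 is a budget in units of 1/(m + 1): one unit for the points with too few
    visits, two for the required loss, since (N + 1) \<mu> I \<le> 2 p, and one for approximation
    errors.\<close>
  obtain m :: nat where "4 / (1 - prob V) \<le> real m" using real_arch_simple by blast
  then have m: "4 \<le> real (Suc m) * (1 - prob V)"
    using less by (simp add: V_def pos_divide_le_eq algebra_simps)
  have "real (Suc m) * (1 - prob V) \<le> real (Suc m) * 1" by (intro mult_left_mono) auto
  then have "4 \<le> real (Suc m) * 1" using m by (rule order_trans[rotated])
  then have m4: "4 \<le> Suc m" by simp
  obtain h :: "bool list \<Rightarrow> nat \<Rightarrow> nat" where h: "computable (\<lambda>p. h (fst p) (snd p))"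
    "\<And>x M. \<bar>real (h x M) - real (Suc M) * prob (cyl x)\<bar> \<le> 2"
    using measure_approximation by blast
  define visits where "visits x N y = card {k. k < Suc N \<and> prefix x ((H ^^ k) y)}" for x N y
  define S where "S x N L p = {y. length y = L \<and> p \<le> visits x N y}" for x N L p
  \<comment> \<open>Let \<open>A\<close> be the set of points with at least \<open>p\<close> visits
    visible on their first \<open>L\<close> bits. Up to rounding this says p (1 - 4/(m + 1)) + (N +
    1) \<mu> (cyl x)/(m + 1) < p \<mu> A. As \<mu> V \<le> 1 - 4/(m + 1), it bounds p (\<mu> A -
    \<mu> V) from below, as \<open>exit_estimate\<close> requires.\<close>
  define cert_at where "cert_at x N L p M \<longleftrightarrow>
    Suc M * p * (Suc m - 4) + Suc N * (h x M + 2) < p * Suc m * (\<Sum>y\<in>S x N L p. h y M - 2)" for x N L p M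
  define Nof where "Nof s = fst (prod_decode s)" for s
  define Lof where "Lof s = fst (prod_decode (snd (prod_decode s)))" for s
  define pof where "pof s = fst (prod_decode (snd (prod_decode (snd (prod_decode s)))))" for s
  define Mof where "Mof s = snd (prod_decode (snd (prod_decode (snd (prod_decode s)))))" for s
  define cert where "cert x s \<longleftrightarrow> cert_at x (Nof s) (Lof s) (pof s) (Mof s)" for x s
  define Q where "Q s x y \<longleftrightarrow> prefix x y \<and> (\<forall>k<Suc (Nof s). q ((H ^^ k) y))" for s x y
  have visits_mono: "visits x N y \<le> visits x N z" if "prefix y z" for x N y z
    unfolding visits_def
    by (intro card_mono) (use funpow_H_mono[OF that] in \<open>auto intro: prefix_order.trans\<close>)
  have visits_le: "real (visits x N (initial \<alpha> L)) \<le> birkhoff_sum (indicator (cyl x)) (Suc N) \<alpha>"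
    if "regular \<alpha>" for x N L \<alpha>
    unfolding birkhoff_sum_indicator visits_def of_nat_le_iff
    by (intro card_mono) (use regular_H_cyl[OF that, of _ L] cyl_subset in auto)
  have probS: "(\<Sum>y\<in>S x N L p. prob (cyl y)) = prob {\<alpha>. p \<le> visits x N (initial \<alpha> L)}" for x N L p
    unfolding S_def by (rule prob_clopen[symmetric])
  have finS: "finite (S x N L p)" for x N L p unfolding S_def by (rule finite_strings)
  obtain n where n: "(\<forall>s. \<not> cert (initial \<omega> n) s) \<or>
    (\<exists>s. cert (initial \<omega> n) s \<and> \<omega> \<notin> string_open (Q s (initial \<omega> n)))"
  proof (rule mlrandom_tree_test[of cert Q m \<omega>])
    show "computable (\<lambda>p. cert (fst p) (snd p))"
      unfolding cert_def cert_at_def S_def visits_def Nof_def Lof_def pof_def Mof_def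
      by (intro computable_intros computable_compose2[OF h(1)])
    show "computable (\<lambda>p. Q (fst p) (fst (snd p)) (snd (snd p)))"
      unfolding Q_def Nof_def by (intro computable_intros computable_compose[OF q])
    show "Q s x z" if "Q s x y" "prefix y z" for s x y z
      using that mono funpow_H_mono[OF that(2)] unfolding Q_def by (blast intro: prefix_order.trans)
    show "prob (string_open (Q s x)) \<le> (1 - 1 / real (Suc m)) * prob (cyl x)" if "cert x s" for s x
    proof -
      define N L p M where "N = Nof s" and "L = Lof s" and "p = pof s" and "M = Mof s"
      define A where "A = {\<alpha>. p \<le> visits x N (initial \<alpha> L)}"
      have [measurable, simp]: "A \<in> sets \<mu>" unfolding A_def by (rule sets_clopen)
      have c: "Suc M * p * (Suc m - 4) + Suc N * (h x M + 2) < p * Suc m * (\<Sum>y\<in>S x N L p. h y M - 2)"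
        using that unfolding cert_def cert_at_def N_def L_def p_def M_def .
      have lo: "real (h y M - 2) \<le> real (Suc M) * prob (cyl y)" for y
      proof -
        have "0 \<le> real (Suc M) * prob (cyl y)" by simp
        then show ?thesis using h(2)[of y M] by linarith
      qed
      have "real (\<Sum>y\<in>S x N L p. h y M - 2) \<le> (\<Sum>y\<in>S x N L p. real (Suc M) * prob (cyl y))"
        unfolding of_nat_sum by (intro sum_mono lo)
      also have "\<dots> = real (Suc M) * prob A"
        unfolding A_def probS[symmetric] sum_distrib_left ..
      finally have up: "real (p * Suc m) * real (\<Sum>y\<in>S x N L p. h y M - 2)
          \<le> real (p * Suc m) * (real (Suc M) * prob A)"
        by (intro mult_left_mono) auto
      have hx: "real (Suc N) * (real (Suc M) * prob (cyl x)) \<le> real (Suc N) * real (h x M + 2)"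
        by (intro mult_left_mono) (use h(2)[of x M] in \<open>auto simp: abs_le_iff algebra_simps\<close>)
      have "real (Suc M * p * (Suc m - 4) + Suc N * (h x M + 2))
          < real (p * Suc m * (\<Sum>y\<in>S x N L p. h y M - 2))"
        using c by (simp only: of_nat_less_iff)
      then have "real (Suc M) * (real p * (real (Suc m) - 4)) + real (Suc N) * (real (Suc M) * prob (cyl x))
          < real (p * Suc m) * (real (Suc M) * prob A)"
        using up hx m4 by (simp only: of_nat_add of_nat_mult of_nat_diff mult.assoc of_nat_numeral)
      then have "real (Suc M) * (real p * (real (Suc m) - 4) + real (Suc N) * prob (cyl x))
          < real (Suc M) * (real (Suc m) * (real p * prob A))"
        by (simp add: algebra_simps)
      then have 1: "real p * (real (Suc m) - 4) + real (Suc N) * prob (cyl x) < real (Suc m) * (real p * prob A)"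
        by (rule mult_left_less_imp_less) simp
      have "real p * (real (Suc m) * prob V) \<le> real p * (real (Suc m) - 4)"
        by (intro mult_left_mono) (use m in \<open>auto simp: algebra_simps\<close>)
      then have 2: "real (Suc N) * prob (cyl x) \<le> real (Suc m) * (real p * (prob A - prob V))"
        using 1 by (simp add: algebra_simps)
      have 3: "real p * (prob A - prob V) \<le> real (Suc N) * (prob (cyl x) - prob (string_open (Q s x)))"
      proof (rule exit_estimate)
        show "AE \<alpha> in \<mu>. \<alpha> \<in> A \<longrightarrow> real p \<le> birkhoff_sum (indicator (cyl x)) (Suc N) \<alpha>"
          using AE_regular
        proof eventually_elim
          case (elim \<alpha>)
          show ?case using visits_le[OF elim, of x N L] by (auto simp: A_def)
        qed
        show "AE \<alpha> in \<mu>. \<alpha> \<in> string_open (Q s x) \<longrightarrow> \<alpha> \<in> cyl x \<and> (\<forall>k\<le>N. (\<tau> ^^ k) \<alpha> \<in> V)"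
          using AE_regular
        proof eventually_elim
          case (elim \<alpha>)
          show ?case
            using funpow_string_open[where q = q, OF elim]
            by (auto simp: string_open_def[of "Q s x"] Q_def V_def N_def prefix_initial_iff less_Suc_eq_le)
        qed
      qed auto
      have "real (Suc N) * prob (cyl x)
          \<le> real (Suc N) * (real (Suc m) * (prob (cyl x) - prob (string_open (Q s x))))"
        using order_trans[OF 2 mult_left_mono[OF 3]] by (simp only: mult.left_commute)
      then have "prob (cyl x) \<le> real (Suc m) * (prob (cyl x) - prob (string_open (Q s x)))"
        by (rule mult_left_le_imp_le) simp
      then have "prob (cyl x) / real (Suc m) \<le> prob (cyl x) - prob (string_open (Q s x))"
        by (simp only: pos_divide_le_eq of_nat_0_less_iff zero_less_Suc mult.commute)
      then show ?thesis by (simp add: left_diff_distrib)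
    qed
  qed (auto simp: Q_def random)
  define x where "x = initial \<omega> n"
  define I where "I = cyl x"
  have [measurable, simp]: "I \<in> sets \<mu>" by (simp add: I_def)
  have pos: "prob I > 0" unfolding I_def x_def by (rule mlrandom_cyl_pos[OF random])
  \<comment> \<open>A certificate for the prefix \<open>x\<close> is now constructed. Half of the
    expected frequency of visits is demanded, outside a set of measure less than one unit 1/(m +
    1).\<close>
  have "\<exists>N. prob {\<alpha> \<in> space \<mu>. birkhoff_sum (indicator I) (Suc N) \<alpha> \<ge> prob I / 2 * real (Suc N)}
      > 1 - 1 / real (Suc m)"
    by (rule birkhoff_indicator_lower) (use pos in auto)
  then obtain N where N: "prob {\<alpha>. birkhoff_sum (indicator I) (Suc N) \<alpha> \<ge> prob I / 2 * real (Suc N)}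
      > 1 - 1 / real (Suc m)" by auto
  define p where "p = nat \<lceil>prob I / 2 * real (Suc N)\<rceil>"
  have "0 < prob I / 2 * real (Suc N)" using pos by simp
  then have p: "prob I / 2 * real (Suc N) \<le> real p" "p > 0" unfolding p_def by linarith+
  have p_le: "p \<le> c" if "prob I / 2 * real (Suc N) \<le> real c" for c
    using that unfolding p_def by linarith
  define F where "F L = {\<alpha>. p \<le> visits x N (initial \<alpha> L)}" for L
  have [measurable, simp]: "F L \<in> sets \<mu>" for L unfolding F_def by (rule sets_clopen)
  have "incseq F"
    unfolding incseq_def F_def using visits_mono[OF prefix_initial] order_trans by blast
  then have lim: "(\<lambda>L. prob (F L)) \<longlonglongrightarrow> prob (\<Union>L. F L)"
    by (intro finite_Lim_measure_incseq) auto
  have "prob {\<alpha>. birkhoff_sum (indicator I) (Suc N) \<alpha> \<ge> prob I / 2 * real (Suc N)} \<le> prob (\<Union>L. F L)"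
  proof (rule finite_measure_mono_AE)
    show "AE \<alpha> in \<mu>. \<alpha> \<in> {\<alpha>. birkhoff_sum (indicator I) (Suc N) \<alpha> \<ge> prob I / 2 * real (Suc N)}
      \<longrightarrow> \<alpha> \<in> (\<Union>L. F L)"
      using AE_regular
    proof (eventually_elim, intro impI)
      fix \<alpha> assume \<alpha>: "regular \<alpha>" and
        "\<alpha> \<in> {\<alpha>. birkhoff_sum (indicator I) (Suc N) \<alpha> \<ge> prob I / 2 * real (Suc N)}"
      then have le: "p \<le> card {k. k < Suc N \<and> (\<tau> ^^ k) \<alpha> \<in> I}"
        by (intro p_le) (simp add: birkhoff_sum_indicator)
      define K where "K = {k. (\<tau> ^^ k) \<alpha> \<in> I}"
      have "\<exists>L\<ge>0. \<forall>k<Suc N. k \<in> K \<longrightarrow> prefix x ((H ^^ k) (initial \<alpha> L))"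
      proof (rule string_open_funpow[OF \<alpha>])
        show "\<forall>k<Suc N. k \<in> K \<longrightarrow> (\<tau> ^^ k) \<alpha> \<in> string_open (prefix x)"
          by (auto simp: K_def I_def string_open_def prefix_initial_iff)
      qed (rule prefix_order.trans)
      then obtain L where L: "\<forall>k<Suc N. k \<in> K \<longrightarrow> prefix x ((H ^^ k) (initial \<alpha> L))" by blast
      have "card {k. k < Suc N \<and> (\<tau> ^^ k) \<alpha> \<in> I} \<le> visits x N (initial \<alpha> L)"
        unfolding visits_def by (intro card_mono) (use L in \<open>auto simp: K_def\<close>)
      then have "p \<le> visits x N (initial \<alpha> L)" using le by linarith
      then show "\<alpha> \<in> (\<Union>L. F L)" by (auto simp: F_def)
    qed
  qed auto
  then have "1 - 1 / real (Suc m) < prob (\<Union>L. F L)" using N by linarith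
  then have "eventually (\<lambda>L. 1 - 1 / real (Suc m) < prob (F L)) sequentially"
    by (rule order_tendstoD(1)[OF lim])
  then obtain L where "1 - 1 / real (Suc m) < prob (F L)" by (auto simp: eventually_sequentially)
  then have "real (Suc m) * (1 - 1 / real (Suc m)) \<le> real (Suc m) * prob (F L)"
    by (intro mult_left_mono) auto
  then have L: "real (Suc m) - 1 \<le> real (Suc m) * prob (F L)" by (simp add: right_diff_distrib)
  define c where "c = real (card (S x N L p))"
  \<comment> \<open>With u = (M + 1) p and v = m + 1, the left side of the certificate is at most u
    (v - 2) + 4 (N + 1), the right side at least u (v - 1) - 4 p v c. \<open>M\<close> makes the
    difference \<open>u\<close> exceed both error terms together.\<close>
  obtain M :: nat where M: "4 * real (Suc N) + 4 * real p * real (Suc m) * c < real M"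
    using reals_Archimedean2 by blast
  have M': "4 * real (Suc N) + 4 * real p * real (Suc m) * c < real (Suc M) * real p"
  proof -
    have "real M \<le> real (Suc M) * 1" by simp
    also have "\<dots> \<le> real (Suc M) * real p" by (intro mult_left_mono) (use p in auto)
    finally show ?thesis using M by linarith
  qed
  have hx: "real (Suc N) * real (h x M + 2) \<le> 2 * (real (Suc M) * real p) + 4 * real (Suc N)"
  proof -
    have "real (Suc N) * real (h x M + 2) \<le> real (Suc N) * (real (Suc M) * prob I + 4)"
      by (intro mult_left_mono) (use h(2)[of x M] in \<open>auto simp: abs_le_iff algebra_simps I_def\<close>)
    also have "\<dots> = 2 * (real (Suc M) * (prob I / 2 * real (Suc N))) + 4 * real (Suc N)"
      by (simp add: algebra_simps)
    also have "\<dots> \<le> 2 * (real (Suc M) * real p) + 4 * real (Suc N)"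
      by (intro add_right_mono mult_left_mono p) auto
    finally show ?thesis .
  qed
  have hS: "real (Suc M) * prob (F L) - 4 * c \<le> real (\<Sum>y\<in>S x N L p. h y M - 2)"
  proof -
    have "real (Suc M) * prob (F L) - 4 * c = (\<Sum>y\<in>S x N L p. real (Suc M) * prob (cyl y) - 4)"
      unfolding F_def probS[symmetric] c_def sum_distrib_left by (simp add: sum_subtractf)
    also have "\<dots> \<le> (\<Sum>y\<in>S x N L p. real (h y M - 2))"
    proof (rule sum_mono)
      show "real (Suc M) * prob (cyl y) - 4 \<le> real (h y M - 2)" for y
        using h(2)[of y M] by linarith
    qed
    finally show ?thesis by simp
  qed
  have "real (Suc M * p * (Suc m - 4) + Suc N * (h x M + 2)) < real (p * Suc m * (\<Sum>y\<in>S x N L p. h y M - 2))"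
  proof -
    define u v where "u = real (Suc M) * real p" and "v = real (Suc m)"
    have "real (Suc M * p * (Suc m - 4) + Suc N * (h x M + 2)) \<le> u * (v - 4) + (2 * u + 4 * real (Suc N))"
      using hx m4 unfolding u_def v_def
      by (simp only: of_nat_add of_nat_mult of_nat_diff of_nat_numeral)
    also have "\<dots> < u * (v - 1) - 4 * real p * v * c"
      using M' unfolding u_def[symmetric] v_def[symmetric] by (simp add: algebra_simps)
    also have "\<dots> \<le> u * (v * prob (F L)) - 4 * real p * v * c"
      using mult_left_mono[OF L, of u] by (simp add: u_def v_def)
    also have "\<dots> = real p * v * (real (Suc M) * prob (F L) - 4 * c)"
      by (simp add: u_def algebra_simps)
    also have "\<dots> \<le> real p * v * real (\<Sum>y\<in>S x N L p. h y M - 2)"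
      by (intro mult_left_mono hS) (auto simp: v_def)
    finally show ?thesis unfolding v_def by (simp only: of_nat_mult)
  qed
  then have "cert_at x N L p M" unfolding cert_at_def by (simp only: of_nat_less_iff)
  then have "cert x (prod_encode (N, prod_encode (L, prod_encode (p, M))))"
    by (simp add: cert_def Nof_def Lof_def pof_def Mof_def)
  then obtain s where s: "\<omega> \<notin> string_open (Q s x)" using n x_def by blast
  show ?thesis
  proof (rule ccontr)
    assume "\<nexists>k. (\<tau> ^^ k) \<omega> \<notin> string_open q"
    then have "\<exists>l\<ge>n. \<forall>k<Suc (Nof s). k \<in> UNIV \<longrightarrow> q ((H ^^ k) (initial \<omega> l))"
      by (intro string_open_funpow[OF mlrandom_regular[OF random]]) (blast intro: mono)+
    then obtain l where "l \<ge> n" "\<forall>k<Suc (Nof s). q ((H ^^ k) (initial \<omega> l))" by blast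
    then have "Q s x (initial \<omega> l)" by (simp add: Q_def x_def prefix_initial)
    then show False using s unfolding string_open_def by blast
  qed
qed

section \<open>Time averages along random orbits\<close>

lemma mlrandom_birkhoff_upper:
  assumes q: "computable q" and mono: "\<And>x y. prefix x y \<Longrightarrow> q x \<Longrightarrow> q y"
    and less: "prob (string_open q) < r" and random: "mlrandom \<mu> \<omega>"
  shows "\<exists>j. \<forall>n. birkhoff_sum (indicator (string_open q)) n \<omega> \<le> real j + r * real n"
proof -
  define V where "V = string_open q"
  have reg: "regular \<omega>" using random by (rule mlrandom_regular)
  \<comment> \<open>A rational threshold, multiplied out, makes the comparison of averages decidable
    in \<open>nat\<close>.\<close>
  obtain t where t: "t \<in> \<rat>" "prob V < t" "t < r"
    using Rats_dense_in_real[OF less] unfolding V_def by blast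
  have "0 < t" using t(2) measure_nonneg[of \<mu> V] by linarith
  obtain a b :: nat where ab: "b \<noteq> 0" "\<bar>t\<bar> = real a / real b"
    using t(1) by (rule Rats_abs_nat_div_natE)
  have t_eq: "t = real a / real b" using ab \<open>0 < t\<close> by simp
  \<comment> \<open>Bounding \<open>k\<close> by the length of \<open>y\<close> keeps the search
    finite and loses nothing, since a point has arbitrarily long prefixes.\<close>
  define G where "G y \<longleftrightarrow> (\<exists>k<Suc (length y). a * k < b * card {i. i < k \<and> q ((H ^^ i) y)})" for y
  have exceeds: "real c > t * real k \<longleftrightarrow> a * k < b * c" for c k
  proof -
    have "t * real k < real c \<longleftrightarrow> real (a * k) < real (b * c)"
      using ab(1) by (simp add: t_eq field_simps)
    then show ?thesis by (simp only: of_nat_less_iff)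
  qed
  have G_iff: "\<alpha> \<in> string_open G \<longleftrightarrow> (\<exists>n. birkhoff_sum (indicator V) n \<alpha> > t * real n)" if \<alpha>: "regular \<alpha>" for \<alpha>
  proof
    assume "\<alpha> \<in> string_open G"
    then obtain l k where "a * k < b * card {i. i < k \<and> q ((H ^^ i) (initial \<alpha> l))}"
      by (auto simp: string_open_def G_def)
    moreover have "card {i. i < k \<and> q ((H ^^ i) (initial \<alpha> l))} \<le> card {i. i < k \<and> (\<tau> ^^ i) \<alpha> \<in> V}"
      by (intro card_mono) (auto simp: V_def intro: funpow_string_open[OF \<alpha>])
    ultimately have "a * k < b * card {i. i < k \<and> (\<tau> ^^ i) \<alpha> \<in> V}"
      by (meson less_le_trans mult_le_mono2)
    then show "\<exists>n. birkhoff_sum (indicator V) n \<alpha> > t * real n"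
      unfolding birkhoff_sum_indicator exceeds by blast
  next
    assume "\<exists>n. birkhoff_sum (indicator V) n \<alpha> > t * real n"
    then obtain k where k: "a * k < b * card {i. i < k \<and> (\<tau> ^^ i) \<alpha> \<in> V}"
      unfolding birkhoff_sum_indicator exceeds by blast
    define K where "K = {i. (\<tau> ^^ i) \<alpha> \<in> V}"
    have "\<exists>l\<ge>k. \<forall>i<k. i \<in> K \<longrightarrow> q ((H ^^ i) (initial \<alpha> l))"
      by (rule string_open_funpow[OF \<alpha> mono]) (auto simp: K_def V_def)
    then obtain l where l: "k \<le> l" "\<forall>i<k. i \<in> K \<longrightarrow> q ((H ^^ i) (initial \<alpha> l))" by blast
    have "card {i. i < k \<and> (\<tau> ^^ i) \<alpha> \<in> V} \<le> card {i. i < k \<and> q ((H ^^ i) (initial \<alpha> l))}"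
      by (intro card_mono) (use l in \<open>auto simp: K_def\<close>)
    then have "a * k < b * card {i. i < k \<and> q ((H ^^ i) (initial \<alpha> l))}"
      using k by (meson less_le_trans mult_le_mono2)
    then have "G (initial \<alpha> l)" using l(1) unfolding G_def by (intro exI[of _ k]) auto
    then show "\<alpha> \<in> string_open G" unfolding string_open_def by blast
  qed
  have "\<exists>j. (\<tau> ^^ j) \<omega> \<notin> string_open G"
  proof (rule mlrandom_leaves_open[OF _ _ _ random])
    show "computable G"
      unfolding G_def[abs_def] by (intro computable_intros computable_compose[OF q])
    show "G y" if xy: "prefix x y" and Gx: "G x" for x y
    proof -
      obtain k where k: "k < Suc (length x)" "a * k < b * card {i. i < k \<and> q ((H ^^ i) x)}"
        using Gx unfolding G_def by blast
      have "card {i. i < k \<and> q ((H ^^ i) x)} \<le> card {i. i < k \<and> q ((H ^^ i) y)}"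
        by (intro card_mono) (use mono funpow_H_mono[OF xy] in auto)
      then have "a * k < b * card {i. i < k \<and> q ((H ^^ i) y)}"
        using k by (meson less_le_trans mult_le_mono2)
      then show ?thesis
        using k(1) prefix_length_le[OF xy] unfolding G_def by (intro exI[of _ k]) auto
    qed
    have "prob (string_open G) \<le> prob {\<alpha> \<in> space \<mu>. \<exists>n. birkhoff_sum (indicator V) n \<alpha> > t * real n}"
    proof (rule finite_measure_mono_AE)
      show "AE \<alpha> in \<mu>. \<alpha> \<in> string_open G \<longrightarrow> \<alpha> \<in> {\<alpha> \<in> space \<mu>. \<exists>n. birkhoff_sum (indicator V) n \<alpha> > t * real n}"
        using AE_regular by eventually_elim (simp add: G_iff)
      have [measurable]: "V \<in> sets \<mu>" by (simp add: V_def)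
      show "{\<alpha> \<in> space \<mu>. \<exists>n. birkhoff_sum (indicator V) n \<alpha> > t * real n} \<in> sets \<mu>"
        by measurable
    qed
    also have "\<dots> < 1" by (rule birkhoff_indicator_upper) (use t in \<open>auto simp: V_def\<close>)
    finally show "prob (string_open G) < 1" .
  qed
  then obtain j where "(\<tau> ^^ j) \<omega> \<notin> string_open G" by blast
  then have le: "birkhoff_sum (indicator V) n ((\<tau> ^^ j) \<omega>) \<le> t * real n" for n
    using G_iff[OF regular_funpow[OF reg]] by (simp add: not_less)
  have "birkhoff_sum (indicator V) n \<omega> \<le> real j + r * real n" for n
  proof -
    \<comment> \<open>The bound \<open>le\<close> starts at time \<open>j\<close>. Extending the sum
      to \<open>n + j\<close> terms only increases it, and the first \<open>j\<close> terms are then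
      split off at a cost of at most \<open>j\<close>.\<close>
    have "birkhoff_sum (indicator V) n \<omega> \<le> birkhoff_sum (indicator V) (n + j) \<omega>"
      unfolding birkhoff_sum_add by (simp add: birkhoff_sum_indicator)
    also have "\<dots> = birkhoff_sum (indicator V) j \<omega> + birkhoff_sum (indicator V) n ((\<tau> ^^ j) \<omega>)"
      by (simp only: add.commute[of n] birkhoff_sum_add)
    also have "birkhoff_sum (indicator V) j \<omega> \<le> real j"
    proof -
      have "card {k. k < j \<and> (\<tau> ^^ k) \<omega> \<in> V} \<le> card {..<j}" by (intro card_mono) auto
      then show ?thesis by (simp add: birkhoff_sum_indicator)
    qed
    also have "birkhoff_sum (indicator V) n ((\<tau> ^^ j) \<omega>) \<le> t * real n" by (rule le)
    also have "t * real n \<le> r * real n" using t by (intro mult_right_mono) auto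
    finally show ?thesis by simp
  qed
  then show ?thesis unfolding V_def by blast
qed

lemma mlrandom_birkhoff:
  assumes q: "computable q" and mono: "\<And>x y. prefix x y \<Longrightarrow> q x \<Longrightarrow> q y"
    and random: "mlrandom \<mu> \<omega>"
  shows "(\<lambda>n. birkhoff_sum (indicator (string_open q)) n \<omega> / real n) \<longlonglongrightarrow> prob (string_open q)"
proof (rule LIMSEQ_I)
  define V where "V = string_open q"
  fix \<epsilon> :: real assume \<epsilon>: "0 < \<epsilon>"
  have "\<exists>j. \<forall>n. birkhoff_sum (indicator V) n \<omega> \<le> real j + (prob V + \<epsilon> / 2) * real n"
    unfolding V_def by (rule mlrandom_birkhoff_upper[OF q _ _ random]) (use mono \<epsilon> in auto)
  then obtain j1 where j1: "\<And>n. birkhoff_sum (indicator V) n \<omega> \<le> real j1 + (prob V + \<epsilon> / 2) * real n"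
    by blast
  \<comment> \<open>An approximation within \<epsilon>/4 puts the measure of the clopen complement
    strictly below 1 - \<mu> V + \<epsilon>/2, as the upper bound demands.\<close>
  have "prob V - \<epsilon> / 4 < prob V" using \<epsilon> by simp
  then have "eventually (\<lambda>s. prob V - \<epsilon> / 4 < prob {\<alpha>. q (initial \<alpha> s)}) sequentially"
    using order_tendstoD(1)[OF string_open_approximation[of q]] mono unfolding V_def by blast
  then obtain s where s: "prob V - \<epsilon> / 4 < prob {\<alpha>. q (initial \<alpha> s)}"
    by (auto simp: eventually_sequentially)
  define q' where "q' y \<longleftrightarrow> s \<le> length y \<and> \<not> q (take s y)" for y
  have q'_open: "string_open q' = UNIV - {\<alpha>. q (initial \<alpha> s)}"
    by (auto simp: string_open_def q'_def min_absorb1)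
  have prob': "prob (string_open q') = 1 - prob {\<alpha>. q (initial \<alpha> s)}"
    using prob_compl[of "{\<alpha>. q (initial \<alpha> s)}"] by (simp add: q'_open)
  have q': "computable q'" unfolding q'_def[abs_def] by (intro computable_intros computable_compose[OF q])
  have mono': "q' y" if "prefix x y" "q' x" for x y using that by (auto simp: q'_def prefix_def)
  have "\<exists>j. \<forall>n. birkhoff_sum (indicator (string_open q')) n \<omega> \<le> real j + (1 - prob V + \<epsilon> / 2) * real n"
    by (rule mlrandom_birkhoff_upper[OF q' _ _ random]) (use mono' s \<epsilon> prob' in auto)
  then obtain j2 where
    j2: "\<And>n. birkhoff_sum (indicator (string_open q')) n \<omega> \<le> real j2 + (1 - prob V + \<epsilon> / 2) * real n"
    by blast
  have cover: "\<beta> \<in> string_open q' \<or> \<beta> \<in> V" for \<beta>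
    unfolding q'_open V_def by (auto simp: string_open_def)
  \<comment> \<open>Every orbit point lies in \<open>V\<close> or in the complement of its clopen
    subset, so few visits to the latter force many visits to \<open>V\<close>.\<close>
  have lower: "(prob V - \<epsilon> / 2) * real n - real j2 \<le> birkhoff_sum (indicator V) n \<omega>" for n
  proof -
    have "real n - birkhoff_sum (indicator (string_open q')) n \<omega> = (\<Sum>k<n. 1 - indicator (string_open q') ((\<tau> ^^ k) \<omega>))"
      by (simp add: birkhoff_sum_def sum_subtractf)
    also have "\<dots> \<le> birkhoff_sum (indicator V) n \<omega>"
      unfolding birkhoff_sum_def
      by (intro sum_mono) (use cover in \<open>auto simp: indicator_def\<close>)
    finally show ?thesis using j2[of n] by (simp add: algebra_simps)
  qed
  \<comment> \<open>From \<open>n0\<close> on, the constants \<open>j1\<close> and \<open>j2\<close>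
    together contribute less than \<epsilon>/2 to the average.\<close>
  obtain n0 :: nat where n0: "2 * (real j1 + real j2) / \<epsilon> < real n0" using reals_Archimedean2 by blast
  have "\<bar>birkhoff_sum (indicator V) n \<omega> / real n - prob V\<bar> < \<epsilon>" if "n \<ge> n0" for n
  proof -
    have "2 * (real j1 + real j2) / \<epsilon> < real n" using n0 that by linarith
    then have n: "real j1 + real j2 < \<epsilon> / 2 * real n" using \<epsilon> by (simp add: field_simps)
    have "0 < real n" using n0 that \<epsilon> by (intro le_less_trans[OF _ less_le_trans[OF n0]]) auto
    have "birkhoff_sum (indicator V) n \<omega> < (prob V + \<epsilon>) * real n"
      using j1[of n] n by (simp add: algebra_simps)
    moreover have "(prob V - \<epsilon>) * real n < birkhoff_sum (indicator V) n \<omega>"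
      using lower[of n] n by (simp add: algebra_simps)
    ultimately have "birkhoff_sum (indicator V) n \<omega> / real n < prob V + \<epsilon>"
      "prob V - \<epsilon> < birkhoff_sum (indicator V) n \<omega> / real n"
      using \<open>0 < real n\<close> by (simp_all add: pos_divide_less_eq pos_less_divide_eq)
    then show ?thesis by linarith
  qed
  then show "\<exists>n0. \<forall>n\<ge>n0. norm (birkhoff_sum (indicator (string_open q)) n \<omega> / real n - prob (string_open q)) < \<epsilon>"
    unfolding V_def by auto
qed

end

theorem theorem8:
  fixes \<mu> :: "cantor measure"
    and T :: "cantor \<Rightarrow> cantor option"
    and U :: "cantor set"
    and \<omega> :: cantor
  assumes "prob_space \<mu>" and "sets \<mu> = sets borel" and "computable_measure \<mu>"
    and "computable_map T" and "ae_defined \<mu> T" and "preserving \<mu> T" and "ergodic \<mu> T"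
    and "eff_open U"
    and "mlrandom \<mu> \<omega>"
  shows "\<exists>x. (\<forall>k. iterate T k \<omega> = Some (x k)) \<and>
    (\<lambda>n. (1 / real n) * (\<Sum>k<n. indicator U (x k))) \<longlonglongrightarrow> measure \<mu> U"
proof -
  obtain H where H: "computable H" "\<And>x y. prefix x y \<Longrightarrow> prefix (H x) (H y)"
    "\<And>\<omega> \<alpha>. T \<omega> = Some \<alpha> \<longleftrightarrow>
       (\<forall>k. \<exists>l. k < length (H (initial \<omega> l)) \<and> H (initial \<omega> l) ! k = \<alpha> k)"
    using computable_map_string_map[OF assms(4)] by blast
  obtain q where q: "computable q" "\<And>x y. prefix x y \<Longrightarrow> q x \<Longrightarrow> q y" "U = string_open q"
    using eff_open_string_open[OF assms(8)] by blast
  interpret prob_space \<mu> by fact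
  interpret computable_dynamics \<mu> T H
    by standard (use assms H in auto)
  show ?thesis
  proof (intro exI[of _ "\<lambda>k. (\<tau> ^^ k) \<omega>"] conjI allI)
    show "iterate T k \<omega> = Some ((\<tau> ^^ k) \<omega>)" for k
      by (rule regular_iterate[OF mlrandom_regular[OF assms(9)]])
    show "(\<lambda>n. (1 / real n) * (\<Sum>k<n. indicator U ((\<tau> ^^ k) \<omega>))) \<longlonglongrightarrow> measure \<mu> U"
      using mlrandom_birkhoff[OF q(1) _ assms(9)] q(2) by (simp add: q(3) birkhoff_sum_def)
  qed
qed

end
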